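(* Let $\Omega\subset\mathbb{C}^m$ be a bounded domain and let $K:\Omega\times\Omega\to\mathbb{C}$ be a sesqui-analytic function for which a continuous branch of $\log K$ exists on $\Omega\times\Omega$, such that $K^\alpha$ and $K^\beta$ are non-negative definite on $\Omega\times\Omega$ for some $\alpha,\beta>0$. Suppose that the multiplication operators $M_{z_i}$, $i=1,\dots,m$, are bounded on both $(\mathcal{H},K^\alpha)$ and $(\mathcal{H},K^\beta)$. Then the Hilbert module $\mathcal{S}_1$ over $\mathbb{C}[z_1,\dots,z_{2m}]$ is isomorphic to the push-forward module $\iota_\star(\mathcal{H},\mathbb{K}^{(\alpha,\beta)})$ via the module map ${\mathcal{R}_1}_{|\mathcal{S}_1}$.
   Context: A function on $\Omega\times\Omega$ is sesqui-analytic if it is holomorphic in the first $m$ variables and anti-holomorphic in the second $m$ variables; $K^t:=\exp(t\log K)$ for the given branch of $\log K$. For a sesqui-analytic non-negative definite kernel $L:\Omega\times\Omega\to\mathcal{M}_k(\mathbb{C})$, $(\mathcal{H},L)$ is the reproducing kernel Hilbert space of $\mathbb{C}^k$-valued holomorphic functions on $\Omega$ with $\langle f,L(\cdot,w)\eta\rangle=\langle f(w),\eta\rangle$; $M_{z_i}$ is multiplication by the $i$th coordinate function. The kernel $\mathbb{K}^{(\alpha,\beta)}(z,w):=K^{\alpha+\beta}(z,w)\big((\partial_i\bar\partial_j\log K)(z,w)\big)_{i,j=1}^m$, with $\partial_i=\frac{\partial}{\partial z_i}$, $\bar\partial_j=\frac{\partial}{\partial\bar w_j}$, is non-negative definite under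 these hypotheses. A Hilbert module over a unital complex algebra $\mathbb{A}$ is a Hilbert space $\mathcal{M}$ with a map $(a,h)\mapsto a\cdot h$ satisfying $1\cdot h=h$, $(ab)\cdot h=a\cdot(b\cdot h)$, $(a+b)\cdot h=a\cdot h+b\cdot h$, and such that $\mathbf{m}_a:h\mapsto a\cdot h$ is a bounded linear operator for each $a$. Two Hilbert modules over $\mathbb{A}$ are isomorphic if there is a unitary $U$ between them with $U(a\cdot h)=a\cdot Uh$ for all $a,h$. The space $(\mathcal{H},K^\alpha)\otimes(\mathcal{H},K^\beta)$ is realized as the Hilbert space of holomorphic functions $f(z,\zeta)$ on $\Omega\times\Omega$ with reproducing kernel $K^\alpha(z,z')K^\beta(\zeta,\zeta')$; it is a Hilbert module over $\mathbb{C}[z_1,\dots,z_{2m}]$ under pointwise multiplication (the variables $z_{m+1},\dots,z_{2m}$ being the coordinates of $\zeta$). Let $\Delta=\{(z,z):z\in\Omega\}$, let $\partial_i f$ ($1\le i\le 2m$) be the derivative in the $i$th variable, and $\mathcal{A}_0=\{f: f_{|\Delta}=0\}$, $\mathcal{A}_1=\{f: f_{|\Delta}=(\partial_{m+1}f)_{|\Delta}=\cdots=(\partial_{2m}f)_{|\Delta}=0\}$, subspaces of $(\mathcal{H},K^\alpha)\otimes(\mathcal{H},K^\beta)$. Put $\mathcal{S}_1=\mathcal{A}_0\ominus\mathcal{A}_1$, with module action given by compression: $\mathbf{m}_p h=P_{\mathcal{S}_1}(ph)$, $h\in\mathcal{S}_1$, $p\in\mathbb{C}[z_1,\dots,z_{2m}]$.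 The map $\mathcal{R}_1:(\mathcal{H},K^\alpha)\otimes(\mathcal{H},K^\beta)\to\mathrm{Hol}(\Omega,\mathbb{C}^m)$ is $$\mathcal{R}_1(f)=\frac{1}{\sqrt{\alpha\beta(\alpha+\beta)}}\big((\beta\partial_j f-\alpha\partial_{m+j}f)_{|\Delta}\big)_{j=1}^m .$$ With $\iota:\Omega\to\Omega\times\Omega$, $\iota(z)=(z,z)$, the push-forward $\iota_\star\mathcal{M}$ of a Hilbert module $\mathcal{M}$ of functions on $\Omega$ over $\mathbb{C}[z_1,\dots,z_m]$ (pointwise multiplication) is the same Hilbert space $\mathcal{M}$ regarded as a module over $\mathbb{C}[z_1,\dots,z_{2m}]$ via $\mathbf{m}_p(h)=(p\circ\iota)h$. *)

theory Defs
  imports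
    "HOL-Analysis.Analysis"
    "HOL-Library.Function_Algebras"
    "HOL-Library.Poly_Mapping"
begin

section \<open>Hilbert spaces and Hilbert modules\<close>

text \<open>A complex Hilbert space is a subspace \<open>V\<close> of an ambient complex vector space together with
  an inner product, linear in the first argument. The values of \<open>ip\<close> outside \<open>V\<close> are irrelevant.\<close>

definition hnorm :: "('h \<Rightarrow> 'h \<Rightarrow> complex) \<Rightarrow> 'h \<Rightarrow> real" where
  "hnorm ip f = sqrt (Re (ip f f))"

locale hilbert_space = vector_space scale
  for scale :: "complex \<Rightarrow> 'h::ab_group_add \<Rightarrow> 'h" +
  fixes V :: "'h set" and ip :: "'h \<Rightarrow> 'h \<Rightarrow> complex"
  assumes subspace: "subspace V"
    and ip_add: "\<lbrakk>f \<in> V; g \<in> V; h \<in> V\<rbrakk> \<Longrightarrow> ip (f + g) h = ip f h + ip g h"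
    and ip_scale: "\<lbrakk>f \<in> V; g \<in> V\<rbrakk> \<Longrightarrow> ip (scale c f) g = c * ip f g"
    and ip_cnj: "\<lbrakk>f \<in> V; g \<in> V\<rbrakk> \<Longrightarrow> ip g f = cnj (ip f g)"
    and ip_pos: "\<lbrakk>f \<in> V; f \<noteq> 0\<rbrakk> \<Longrightarrow> 0 < Re (ip f f)"
    and complete:
      "\<lbrakk>\<And>n::nat. X n \<in> V; \<And>e. e > 0 \<Longrightarrow> \<exists>N. \<forall>p\<ge>N. \<forall>q\<ge>N. hnorm ip (X p - X q) < e\<rbrakk>
        \<Longrightarrow> \<exists>f\<in>V. (\<lambda>n. hnorm ip (X n - f)) \<longlonglongrightarrow> 0"

definition linear_betw ::
  "(complex \<Rightarrow> 'h::ab_group_add \<Rightarrow> 'h) \<Rightarrow> 'h set \<Rightarrow>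
   (complex \<Rightarrow> 'g::ab_group_add \<Rightarrow> 'g) \<Rightarrow> 'g set \<Rightarrow> ('h \<Rightarrow> 'g) \<Rightarrow> bool" where
  "linear_betw s V s' V' T \<longleftrightarrow>
     T ` V \<subseteq> V' \<and>
     (\<forall>f\<in>V. \<forall>g\<in>V. T (f + g) = T f + T g) \<and>
     (\<forall>c. \<forall>f\<in>V. T (s c f) = s' c (T f))"

definition bounded_operator ::
  "(complex \<Rightarrow> 'h::ab_group_add \<Rightarrow> 'h) \<Rightarrow> 'h set \<Rightarrow> ('h \<Rightarrow> 'h \<Rightarrow> complex) \<Rightarrow> ('h \<Rightarrow> 'h) \<Rightarrow> bool" where
  "bounded_operator s V ip T \<longleftrightarrow>
     linear_betw s V s V T \<and> (\<exists>C. \<forall>f\<in>V. hnorm ip (T f) \<le> C * hnorm ip f)"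

locale hilbert_module = hilbert_space scale V ip
  for scale :: "complex \<Rightarrow> 'h::ab_group_add \<Rightarrow> 'h" and V :: "'h set" and ip :: "'h \<Rightarrow> 'h \<Rightarrow> complex" +
  fixes act :: "'a::ring_1 \<Rightarrow> 'h \<Rightarrow> 'h"
  assumes act_one: "h \<in> V \<Longrightarrow> act 1 h = h"
    and act_mult: "h \<in> V \<Longrightarrow> act (a * b) h = act a (act b h)"
    and act_add: "h \<in> V \<Longrightarrow> act (a + b) h = act a h + act b h"
    and act_bounded: "bounded_operator scale V ip (act a)"

definition hilbert_module_isomorphism ::
  "(complex \<Rightarrow> 'h::ab_group_add \<Rightarrow> 'h) \<Rightarrow> 'h set \<Rightarrow> ('h \<Rightarrow> 'h \<Rightarrow> complex) \<Rightarrow> ('a::ring_1 \<Rightarrow> 'h \<Rightarrow> 'h) \<Rightarrow>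
   (complex \<Rightarrow> 'g::ab_group_add \<Rightarrow> 'g) \<Rightarrow> 'g set \<Rightarrow> ('g \<Rightarrow> 'g \<Rightarrow> complex) \<Rightarrow> ('a \<Rightarrow> 'g \<Rightarrow> 'g) \<Rightarrow>
   ('h \<Rightarrow> 'g) \<Rightarrow> bool" where
  "hilbert_module_isomorphism s V ip act s' V' ip' act' U \<longleftrightarrow>
     hilbert_module s V ip act \<and> hilbert_module s' V' ip' act' \<and>
     linear_betw s V s' V' U \<and> bij_betw U V V' \<and>
     (\<forall>f\<in>V. \<forall>g\<in>V. ip' (U f) (U g) = ip f g) \<and>
     (\<forall>a. \<forall>h\<in>V. U (act a h) = act' a (U h))"

definition orth_diff :: "('h \<Rightarrow> 'h \<Rightarrow> complex) \<Rightarrow> 'h set \<Rightarrow> 'h set \<Rightarrow> 'h set" where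
  "orth_diff ip A B = {f \<in> A. \<forall>g\<in>B. ip f g = 0}"

definition orth_proj :: "('h::ab_group_add \<Rightarrow> 'h \<Rightarrow> complex) \<Rightarrow> 'h set \<Rightarrow> 'h \<Rightarrow> 'h" where
  "orth_proj ip S h = (THE s. s \<in> S \<and> (\<forall>g\<in>S. ip (h - s) g = 0))"


section \<open>Functions of several complex variables\<close>

definition holomorphic_sev :: "(complex^'n \<Rightarrow> complex) \<Rightarrow> (complex^'n) set \<Rightarrow> bool" where
  "holomorphic_sev f S \<longleftrightarrow>
     (\<forall>z\<in>S. \<exists>D. (f has_derivative D) (at z) \<and> (\<forall>c v. D (c *s v) = c * D v))"

definition sesqui_analytic :: "(complex^'n \<Rightarrow> complex^'n \<Rightarrow> complex) \<Rightarrow> (complex^'n) set \<Rightarrow> bool" where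
  "sesqui_analytic K S \<longleftrightarrow>
     (\<forall>w\<in>S. holomorphic_sev (\<lambda>z. K z w) S) \<and>
     (\<forall>z\<in>S. holomorphic_sev (\<lambda>w. cnj (K z w)) S)"

definition pderiv_hol :: "'n \<Rightarrow> (complex^'n \<Rightarrow> complex) \<Rightarrow> complex^'n \<Rightarrow> complex" where
  "pderiv_hol i f z = deriv (\<lambda>t. f (z + axis i t)) 0"

text \<open>For antiholomorphic \<open>g\<close>, the derivative of \<open>g\<close> with respect to \<open>cnj w\<^sub>j\<close> is the conjugate of the
  \<open>j\<close>th holomorphic derivative of \<open>cnj \<circ> g\<close>.\<close>

definition pderiv_antihol :: "'n \<Rightarrow> (complex^'n \<Rightarrow> complex) \<Rightarrow> complex^'n \<Rightarrow> complex" where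
  "pderiv_antihol j g w = cnj (pderiv_hol j (\<lambda>u. cnj (g u)) w)"

text \<open>The polynomial ring over \<open>\<complex>\<close> in variables indexed by \<open>'v\<close> is the type
  \<open>('v \<Rightarrow>\<^sub>0 nat) \<Rightarrow>\<^sub>0 complex\<close> with the convolution product.\<close>

type_synonym 'v cpoly = "('v \<Rightarrow>\<^sub>0 nat) \<Rightarrow>\<^sub>0 complex"

definition cpoly_eval :: "'v::finite cpoly \<Rightarrow> complex^'v \<Rightarrow> complex" where
  "cpoly_eval p x =
     (\<Sum>\<mu>\<in>Poly_Mapping.keys p. Poly_Mapping.lookup p \<mu> * (\<Prod>i\<in>UNIV. x $ i ^ Poly_Mapping.lookup \<mu> i))"


section \<open>Reproducing kernel Hilbert spaces\<close>

text \<open>Functions on \<open>S\<close> are represented by functions on the whole type that vanish off \<open>S\<close>, so that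
  equality of functions on \<open>S\<close> is equality in HOL.\<close>

definition restr :: "'x set \<Rightarrow> ('x \<Rightarrow> 'v::zero) \<Rightarrow> 'x \<Rightarrow> 'v" where
  "restr S f = (\<lambda>x. if x \<in> S then f x else 0)"

definition fscale :: "complex \<Rightarrow> ('x \<Rightarrow> complex) \<Rightarrow> 'x \<Rightarrow> complex" where
  "fscale c f = (\<lambda>x. c * f x)"

definition vfscale :: "complex \<Rightarrow> ('x \<Rightarrow> complex^'k) \<Rightarrow> 'x \<Rightarrow> complex^'k" where
  "vfscale c f = (\<lambda>x. c *s f x)"

definition nonneg_definite :: "'x set \<Rightarrow> ('x \<Rightarrow> 'x \<Rightarrow> complex) \<Rightarrow> bool" where
  "nonneg_definite S L \<longleftrightarrow>
     (\<forall>F c. finite F \<and> F \<subseteq> S \<longrightarrow> (\<Sum>z\<in>F. \<Sum>w\<in>F. cnj (c z) * c w * L z w) \<in> \<real>\<^sub>\<ge>\<^sub>0)"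

text \<open>\<open>is_rkhs S L V ip\<close>: the Hilbert space \<open>(V, ip)\<close> is \<open>(\<H>, L)\<close>, which is determined by these
  conditions. \<open>is_vrkhs\<close> is the version for matrix-valued \<open>L\<close>.\<close>

definition is_rkhs ::
  "(complex^'n) set \<Rightarrow> (complex^'n \<Rightarrow> complex^'n \<Rightarrow> complex) \<Rightarrow> (complex^'n \<Rightarrow> complex) set \<Rightarrow>
   ((complex^'n \<Rightarrow> complex) \<Rightarrow> (complex^'n \<Rightarrow> complex) \<Rightarrow> complex) \<Rightarrow> bool" where
  "is_rkhs S L V ip \<longleftrightarrow>
     hilbert_space fscale V ip \<and>
     (\<forall>f\<in>V. holomorphic_sev f S \<and> (\<forall>z. z \<notin> S \<longrightarrow> f z = 0)) \<and>
     (\<forall>w\<in>S. restr S (\<lambda>z. L z w) \<in> V \<and> (\<forall>f\<in>V. ip f (restr S (\<lambda>z. L z w)) = f w))"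

definition is_vrkhs ::
  "(complex^'n) set \<Rightarrow> (complex^'n \<Rightarrow> complex^'n \<Rightarrow> complex^'k^'k) \<Rightarrow> (complex^'n \<Rightarrow> complex^'k) set \<Rightarrow>
   ((complex^'n \<Rightarrow> complex^'k) \<Rightarrow> (complex^'n \<Rightarrow> complex^'k) \<Rightarrow> complex) \<Rightarrow> bool" where
  "is_vrkhs S L V ip \<longleftrightarrow>
     hilbert_space vfscale V ip \<and>
     (\<forall>f\<in>V. (\<forall>j. holomorphic_sev (\<lambda>z. f z $ j) S) \<and> (\<forall>z. z \<notin> S \<longrightarrow> f z = 0)) \<and>
     (\<forall>w\<in>S. \<forall>\<eta>. restr S (\<lambda>z. L z w *v \<eta>) \<in> V \<and>
        (\<forall>f\<in>V. ip f (restr S (\<lambda>z. L z w *v \<eta>)) = (\<Sum>j\<in>UNIV. f w $ j * cnj (\<eta> $ j))))"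


section \<open>The kernels, the submodules and the map\<close>

text \<open>\<open>l\<close> is the given branch of \<open>log K\<close>.\<close>

definition kpow :: "('x \<Rightarrow> 'x \<Rightarrow> complex) \<Rightarrow> real \<Rightarrow> 'x \<Rightarrow> 'x \<Rightarrow> complex" where
  "kpow l t z w = exp (of_real t * l z w)"

definition curv_kernel ::
  "(complex^'m \<Rightarrow> complex^'m \<Rightarrow> complex) \<Rightarrow> real \<Rightarrow> real \<Rightarrow> complex^'m \<Rightarrow> complex^'m \<Rightarrow> complex^'m^'m" where
  "curv_kernel l \<alpha> \<beta> z w =
     (\<chi> i j. kpow l (\<alpha> + \<beta>) z w * pderiv_hol i (\<lambda>z'. pderiv_antihol j (\<lambda>w'. l z' w') w) z)"

text \<open>Points of \<open>\<complex>\<^sup>2\<^sup>m\<close> are indexed by \<open>'m + 'm\<close>: \<open>Inl j\<close> is the index \<open>j\<close> and \<open>Inr j\<close> the index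
  \<open>m + j\<close>.\<close>

definition vfst :: "complex^('m + 'm) \<Rightarrow> complex^'m" where
  "vfst x = (\<chi> j. x $ Inl j)"

definition vsnd :: "complex^('m + 'm) \<Rightarrow> complex^'m" where
  "vsnd x = (\<chi> j. x $ Inr j)"

definition sq_dom :: "(complex^'m) set \<Rightarrow> (complex^('m + 'm)) set" where
  "sq_dom \<Omega> = {x. vfst x \<in> \<Omega> \<and> vsnd x \<in> \<Omega>}"

definition diag :: "complex^'m \<Rightarrow> complex^('m + 'm)" where
  "diag z = (\<chi> i. case i of Inl j \<Rightarrow> z $ j | Inr j \<Rightarrow> z $ j)"

definition tensor_kernel ::
  "(complex^'m \<Rightarrow> complex^'m \<Rightarrow> complex) \<Rightarrow> (complex^'m \<Rightarrow> complex^'m \<Rightarrow> complex) \<Rightarrow>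
   complex^('m + 'm) \<Rightarrow> complex^('m + 'm) \<Rightarrow> complex" where
  "tensor_kernel L L' x y = L (vfst x) (vfst y) * L' (vsnd x) (vsnd y)"

definition A0_sub ::
  "(complex^'m) set \<Rightarrow> (complex^('m + 'm) \<Rightarrow> complex) set \<Rightarrow> (complex^('m + 'm) \<Rightarrow> complex) set" where
  "A0_sub \<Omega> V = {f \<in> V. \<forall>z\<in>\<Omega>. f (diag z) = 0}"

definition A1_sub ::
  "(complex^'m) set \<Rightarrow> (complex^('m + 'm) \<Rightarrow> complex) set \<Rightarrow> (complex^('m + 'm) \<Rightarrow> complex) set" where
  "A1_sub \<Omega> V = {f \<in> V. \<forall>z\<in>\<Omega>. f (diag z) = 0 \<and> (\<forall>j. pderiv_hol (Inr j) f (diag z) = 0)}"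

definition S1_space ::
  "(complex^'m) set \<Rightarrow> (complex^('m + 'm) \<Rightarrow> complex) set \<Rightarrow>
   ((complex^('m + 'm) \<Rightarrow> complex) \<Rightarrow> (complex^('m + 'm) \<Rightarrow> complex) \<Rightarrow> complex) \<Rightarrow>
   (complex^('m + 'm) \<Rightarrow> complex) set" where
  "S1_space \<Omega> V ip = orth_diff ip (A0_sub \<Omega> V) (A1_sub \<Omega> V)"

definition compressed_action ::
  "((complex^'v \<Rightarrow> complex) \<Rightarrow> (complex^'v \<Rightarrow> complex) \<Rightarrow> complex) \<Rightarrow> (complex^'v \<Rightarrow> complex) set \<Rightarrow>
   'v::finite cpoly \<Rightarrow> (complex^'v \<Rightarrow> complex) \<Rightarrow> complex^'v \<Rightarrow> complex" where
  "compressed_action ip S p h = orth_proj ip S (\<lambda>x. cpoly_eval p x * h x)"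

definition pushforward_action ::
  "('m::finite + 'm) cpoly \<Rightarrow> (complex^'m \<Rightarrow> complex^'k) \<Rightarrow> complex^'m \<Rightarrow> complex^'k" where
  "pushforward_action p h = (\<lambda>z. cpoly_eval p (diag z) *s h z)"

definition R1_map ::
  "(complex^'m) set \<Rightarrow> real \<Rightarrow> real \<Rightarrow> (complex^('m + 'm) \<Rightarrow> complex) \<Rightarrow> complex^'m \<Rightarrow> complex^'m" where
  "R1_map \<Omega> \<alpha> \<beta> f = restr \<Omega> (\<lambda>z. \<chi> j.
     of_real (1 / sqrt (\<alpha> * \<beta> * (\<alpha> + \<beta>))) *
     (of_real \<beta> * pderiv_hol (Inl j) f (diag z) - of_real \<alpha> * pderiv_hol (Inr j) f (diag z)))"

end

theory Submission
  imports Defs "HOL-Complex_Analysis.Cauchy_Integral_Formula"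
begin

text \<open>The space \<open>T\<close> is the tensor product, with kernel \<open>K\<^sup>\<alpha>(z, z') K\<^sup>\<beta>(\<zeta>, \<zeta>')\<close>. Write \<open>R1\<close> for the map, and
  let \<open>G j w\<close> be the function \<open>z \<mapsto> (\<partial>\<close>bar\<open>\<^sub>j log K)(z, w)\<close> (\<open>log_conj_deriv\<close>).

  On functions that vanish on the diagonal the directions \<open>j\<close> and \<open>m + j\<close> have opposite derivatives, so
  there \<open>R1\<close> is a non-zero multiple of the derivatives in \<open>\<zeta>\<close>, and its kernel in \<open>\<A>\<^sub>0\<close> is \<open>\<A>\<^sub>1\<close>
  (\<open>A1_iff_R1_zero\<close>). Hence \<open>R1\<close> is injective on \<open>\<S>\<^sub>1\<close>.

  Derivatives at a point are bounded functionals, represented by the conjugate derivatives of the kernel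
  (\<open>is_rkhs_pderiv_representer\<close>). Because the logarithmic derivatives of \<open>K\<^sup>\<alpha>\<close> and \<open>K\<^sup>\<beta>\<close> are \<open>\<alpha>\<close> and \<open>\<beta>\<close>
  times \<open>G j w\<close>, the functional \<open>f \<mapsto> \<langle>R1 f w, \<eta>\<rangle>\<close> is represented by a constant multiple of
  \<open>\<Sum>j. \<eta> j (G j w z - G j w \<zeta>) K\<^sup>\<alpha>(z, w) K\<^sup>\<beta>(\<zeta>, w)\<close> (\<open>R1_representer\<close>). This vector vanishes on the
  diagonal and is orthogonal to \<open>\<A>\<^sub>1\<close>, which \<open>R1\<close> kills. So it lies in \<open>\<S>\<^sub>1\<close>, and applying \<open>R1\<close> to it differentiates \<open>G\<close> once more: the result is the
  curvature kernel applied to \<open>\<eta>\<close> (\<open>R1_R1_representer\<close>). The representing vectors in \<open>\<S>\<^sub>1\<close> and the kernel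
  functions of the curvature kernel are therefore total families with the same Gram matrix, and \<open>R1\<close>
  is the unitary between them (\<open>unitary_of_equal_gram\<close>). Carrying the structure of \<open>\<S>\<^sub>1\<close> to its image
  shows that a space with the curvature kernel exists; this uses that derivatives of holomorphic
  functions of several variables are holomorphic (\<open>holomorphic_sev_pderiv_hol\<close>).

  Polynomials act boundedly on \<open>T\<close>: if multiplication by a coordinate is bounded by \<open>C\<close> on one factor, its
  defect kernel \<open>(C\<^sup>2 - z\<^sub>i cnj w\<^sub>i) K\<^sup>\<alpha>(z, w)\<close> is non-negative definite, and remains so after multiplication
  by \<open>K\<^sup>\<beta>\<close> (\<open>Schur_product_Gram\<close>, \<open>product_kernel_multiplier\<close>). They preserve \<open>\<A>\<^sub>0\<close> and \<open>\<A>\<^sub>1\<close>, so compression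
  to \<open>\<S>\<^sub>1\<close> is multiplicative, and by the product rule at a zero \<open>R1\<close> carries it to multiplication by the
  restriction to the diagonal.\<close>

section \<open>Hilbert space geometry\<close>

context hilbert_space
begin

lemma V_zero [simp]: "0 \<in> V"
  using subspace by (rule subspace_0)

lemma V_add [simp]: "f \<in> V \<Longrightarrow> g \<in> V \<Longrightarrow> f + g \<in> V"
  using subspace by (rule subspace_add)

lemma V_scale [simp]: "f \<in> V \<Longrightarrow> scale c f \<in> V"
  using subspace by (rule subspace_scale)

lemma V_diff [simp]: "f \<in> V \<Longrightarrow> g \<in> V \<Longrightarrow> f - g \<in> V"
  using subspace by (rule subspace_diff)

lemma V_sum: "(\<And>i. i \<in> F \<Longrightarrow> k i \<in> V) \<Longrightarrow> sum k F \<in> V"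
  using subspace by (rule subspace_sum)

lemma ip_zero_left [simp]: "f \<in> V \<Longrightarrow> ip 0 f = 0"
  using ip_add[of 0 0 f] by simp

lemma ip_zero_right [simp]: "f \<in> V \<Longrightarrow> ip f 0 = 0"
  using ip_cnj[of 0 f] by simp

lemma ip_add_right: "\<lbrakk>f \<in> V; g \<in> V; h \<in> V\<rbrakk> \<Longrightarrow> ip h (f + g) = ip h f + ip h g"
  using ip_cnj[of "f + g" h] ip_cnj[of f h] ip_cnj[of g h] by (simp add: ip_add)

lemma ip_scale_right: "\<lbrakk>f \<in> V; g \<in> V\<rbrakk> \<Longrightarrow> ip f (scale c g) = cnj c * ip f g"
  using ip_cnj[of "scale c g" f] ip_cnj[of g f] by (simp add: ip_scale)

lemma ip_diff: "\<lbrakk>f \<in> V; g \<in> V; h \<in> V\<rbrakk> \<Longrightarrow> ip (f - g) h = ip f h - ip g h"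
  using ip_add[of "f - g" g h] by simp

lemma ip_diff_right: "\<lbrakk>f \<in> V; g \<in> V; h \<in> V\<rbrakk> \<Longrightarrow> ip h (f - g) = ip h f - ip h g"
  using ip_add_right[of "f - g" g h] by simp

lemma ip_sum: "\<lbrakk>\<And>i. i \<in> F \<Longrightarrow> k i \<in> V; h \<in> V\<rbrakk> \<Longrightarrow> ip (sum k F) h = (\<Sum>i\<in>F. ip (k i) h)"
  by (induction F rule: infinite_finite_induct) (auto simp: ip_add V_sum)

lemma ip_sum_right: "\<lbrakk>\<And>i. i \<in> F \<Longrightarrow> k i \<in> V; h \<in> V\<rbrakk> \<Longrightarrow> ip h (sum k F) = (\<Sum>i\<in>F. ip h (k i))"
  by (induction F rule: infinite_finite_induct) (auto simp: ip_add_right V_sum)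

lemma Re_ip_nonneg: "f \<in> V \<Longrightarrow> 0 \<le> Re (ip f f)"
  using ip_pos[of f] by (cases "f = 0") auto

lemma hnorm_power2: "f \<in> V \<Longrightarrow> (hnorm ip f)\<^sup>2 = Re (ip f f)"
  by (simp add: hnorm_def Re_ip_nonneg)

lemma hnorm_nonneg [simp]: "f \<in> V \<Longrightarrow> 0 \<le> hnorm ip f"
  by (simp add: hnorm_def Re_ip_nonneg)

lemma ip_self: "f \<in> V \<Longrightarrow> ip f f = of_real ((hnorm ip f)\<^sup>2)"
  using ip_cnj[of f f] by (auto simp: hnorm_power2 complex_eq_iff)

lemma hnorm_eq_0 [simp]: "f \<in> V \<Longrightarrow> hnorm ip f = 0 \<longleftrightarrow> f = 0"
  using ip_pos[of f] by (cases "f = 0") (auto simp: hnorm_def)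

lemma hnorm_scale: "f \<in> V \<Longrightarrow> hnorm ip (scale c f) = cmod c * hnorm ip f"
proof -
  assume f: "f \<in> V"
  have "ip (scale c f) (scale c f) = (c * cnj c) * ip f f"
    by (simp add: ip_scale ip_scale_right f)
  then have "(hnorm ip (scale c f))\<^sup>2 = Re ((c * cnj c) * ip f f)"
    by (simp only: hnorm_power2 V_scale f)
  also have "\<dots> = (cmod c * hnorm ip f)\<^sup>2"
    by (simp only: complex_norm_square[symmetric] ip_self[OF f] of_real_mult[symmetric] Re_complex_of_real
      power_mult_distrib)
  finally show ?thesis
    by (simp add: f)
qed

lemma hnorm_add_power2:
  "\<lbrakk>f \<in> V; g \<in> V\<rbrakk> \<Longrightarrow> (hnorm ip (f + g))\<^sup>2 = (hnorm ip f)\<^sup>2 + (hnorm ip g)\<^sup>2 + 2 * Re (ip f g)"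
  using ip_cnj[of g f] by (simp add: hnorm_power2 ip_add ip_add_right)

lemma hnorm_diff_power2:
  "\<lbrakk>f \<in> V; g \<in> V\<rbrakk> \<Longrightarrow> (hnorm ip (f - g))\<^sup>2 = (hnorm ip f)\<^sup>2 + (hnorm ip g)\<^sup>2 - 2 * Re (ip f g)"
  using ip_cnj[of g f] by (simp add: hnorm_power2 ip_diff ip_diff_right)

lemma Cauchy_Schwarz:
  assumes f: "f \<in> V" and g: "g \<in> V"
  shows "cmod (ip f g) \<le> hnorm ip f * hnorm ip g"
proof (cases "g = 0")
  case True
  then show ?thesis using f by simp
next
  case False
  define n where "n = (hnorm ip g)\<^sup>2"
  have n: "n > 0" using False g by (simp add: n_def)
  define c where "c = ip f g / of_real n"
  have "0 \<le> (hnorm ip (f - scale c g))\<^sup>2" by simp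
  also have "\<dots> = (hnorm ip f)\<^sup>2 + (cmod c)\<^sup>2 * n - 2 * Re (cnj c * ip f g)"
    by (simp add: hnorm_diff_power2 f g hnorm_scale ip_scale_right power_mult_distrib n_def)
  also have "cnj c * ip f g = of_real ((cmod (ip f g))\<^sup>2 / n)"
    using complex_norm_square[of "ip f g"] by (simp add: c_def mult.commute)
  also have "(cmod c)\<^sup>2 * n = (cmod (ip f g))\<^sup>2 / n"
    using n by (simp add: c_def norm_divide power_divide power2_eq_square)
  finally have "(cmod (ip f g))\<^sup>2 \<le> (hnorm ip f)\<^sup>2 * n"
    using n by (simp add: field_simps)
  then have "(cmod (ip f g))\<^sup>2 \<le> (hnorm ip f * hnorm ip g)\<^sup>2"
    by (simp add: n_def power_mult_distrib)
  then show ?thesis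
    by (rule power2_le_imp_le) (simp add: f g)
qed

lemma hnorm_triangle:
  assumes f: "f \<in> V" and g: "g \<in> V"
  shows "hnorm ip (f + g) \<le> hnorm ip f + hnorm ip g"
proof -
  have "Re (ip f g) \<le> hnorm ip f * hnorm ip g"
    using Cauchy_Schwarz[OF f g] complex_Re_le_cmod order_trans by blast
  then have "(hnorm ip (f + g))\<^sup>2 \<le> (hnorm ip f + hnorm ip g)\<^sup>2"
    by (simp add: hnorm_add_power2 f g power2_sum)
  then show ?thesis
    by (rule power2_le_imp_le) (simp add: f g)
qed

lemma hnorm_minus_commute:
  assumes "f \<in> V" "g \<in> V"
  shows "hnorm ip (f - g) = hnorm ip (g - f)"
proof -
  have "(hnorm ip (f - g))\<^sup>2 = (hnorm ip (g - f))\<^sup>2"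
    using assms ip_cnj[of f g] by (simp add: hnorm_diff_power2)
  then show ?thesis using assms by simp
qed

lemma ip_tendsto:
  assumes X: "\<And>n. X n \<in> V" and f: "f \<in> V" and g: "g \<in> V"
    and lim: "(\<lambda>n. hnorm ip (X n - f)) \<longlonglongrightarrow> 0"
  shows "(\<lambda>n. ip (X n) g) \<longlonglongrightarrow> ip f g"
proof -
  have "cmod (ip (X n) g - ip f g) \<le> hnorm ip (X n - f) * hnorm ip g" for n
    using Cauchy_Schwarz[of "X n - f" g] by (simp add: ip_diff X f g)
  moreover have "(\<lambda>n. hnorm ip (X n - f) * hnorm ip g) \<longlonglongrightarrow> 0"
    using tendsto_mult_right[OF lim, of "hnorm ip g"] by simp
  ultimately have "(\<lambda>n. ip (X n) g - ip f g) \<longlonglongrightarrow> 0"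
    by (metis (no_types, lifting) Lim_null_comparison eventually_sequentiallyI)
  then show ?thesis by (simp add: LIM_zero_iff)
qed

lemma polarization_eq:
  assumes "hilbert_space s' V' ip'" "linear_betw scale V s' V' U"
    and norm: "\<And>f. f \<in> V \<Longrightarrow> hnorm ip' (U f) = hnorm ip f"
    and f: "f \<in> V" and g: "g \<in> V"
  shows "ip' (U f) (U g) = ip f g"
proof -
  interpret V': hilbert_space s' V' ip' by fact
  have UV: "U f \<in> V'" if "f \<in> V" for f
    using assms(2) that unfolding linear_betw_def by blast
  have Re: "Re (ip' (U f) (U g)) = Re (ip f g)" if "f \<in> V" "g \<in> V" for f g
  proof -
    have "hnorm ip' (U f + U g) = hnorm ip (f + g)"
      using assms(2) that norm[of "f + g"] unfolding linear_betw_def by simp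
    then show ?thesis
      using hnorm_add_power2[OF that] V'.hnorm_add_power2[OF UV UV, OF that] norm that by simp
  qed
  have Us: "U (scale \<i> g) = s' \<i> (U g)"
    using assms(2) g unfolding linear_betw_def by simp
  \<comment> \<open>The imaginary part of a form is the real part of the same form at \<open>(f, \<i> g)\<close>.\<close>
  have "Im (ip' (U f) (U g)) = Im (ip f g)"
    using Re[OF f V_scale[OF g], of \<i>] unfolding Us
    by (simp add: ip_scale_right V'.ip_scale_right UV f g)
  then show ?thesis
    using Re[OF f g] by (simp add: complex_eq_iff)
qed

lemma hnorm_combination_power2:
  assumes "\<And>i. i \<in> F \<Longrightarrow> k i \<in> V"
  shows "of_real ((hnorm ip (\<Sum>i\<in>F. scale (c i) (k i)))\<^sup>2)
    = (\<Sum>i\<in>F. \<Sum>j\<in>F. cnj (c i) * c j * ip (k j) (k i))"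
proof -
  have "of_real ((hnorm ip (\<Sum>i\<in>F. scale (c i) (k i)))\<^sup>2)
      = ip (\<Sum>j\<in>F. scale (c j) (k j)) (\<Sum>i\<in>F. scale (c i) (k i))"
    by (subst ip_self[symmetric]) (auto intro!: V_sum simp: assms)
  also have "\<dots> = (\<Sum>i\<in>F. \<Sum>j\<in>F. cnj (c i) * c j * ip (k j) (k i))"
    by (simp add: ip_sum ip_sum_right V_sum assms ip_scale ip_scale_right sum_distrib_left mult_ac)
  finally show ?thesis .
qed

end

text \<open>\<open>R\<close> is the graph of a bounded linear functional on a subspace. The representing vector is the
  limit of a minimizing sequence of \<open>\<parallel>u\<parallel>\<^sup>2 - 2 Re \<phi>\<close> over \<open>(u, \<phi>) \<in> R\<close>: the parallelogram law makes
  the sequence Cauchy, and the first variation at the limit vanishes.\<close>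

lemma (in hilbert_space) riesz_on_graph:
  assumes RV: "\<And>u \<phi>. (u, \<phi>) \<in> R \<Longrightarrow> u \<in> V"
    and ne: "R \<noteq> {}"
    and add: "\<And>u \<phi> v \<psi>. (u, \<phi>) \<in> R \<Longrightarrow> (v, \<psi>) \<in> R \<Longrightarrow> (u + v, \<phi> + \<psi>) \<in> R"
    and scl: "\<And>u \<phi> c. (u, \<phi>) \<in> R \<Longrightarrow> (scale c u, c * \<phi>) \<in> R"
    and bd: "\<And>u \<phi>. (u, \<phi>) \<in> R \<Longrightarrow> cmod \<phi> \<le> M * hnorm ip u"
    and M: "M \<ge> 0"
  obtains v where "v \<in> V" "hnorm ip v \<le> M" "\<And>u \<phi>. (u, \<phi>) \<in> R \<Longrightarrow> ip u v = \<phi>"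
proof -
  define Q where "Q = (\<lambda>(u, \<phi>). (hnorm ip u)\<^sup>2 - 2 * Re \<phi>)"
  define m where "m = Inf (Q ` R)"
  have low: "- M\<^sup>2 \<le> Q x" if "x \<in> R" for x
  proof -
    obtain u \<phi> where x: "x = (u, \<phi>)" by (cases x)
    have "Re \<phi> \<le> M * hnorm ip u"
      using bd[of u \<phi>] complex_Re_le_cmod[of \<phi>] that x by simp
    moreover have "0 \<le> (hnorm ip u - M)\<^sup>2" by simp
    ultimately show ?thesis by (simp add: Q_def x power2_diff mult_ac)
  qed
  have bdd: "bdd_below (Q ` R)"
    using low by (auto intro!: bdd_belowI)
  have m_le: "m \<le> Q x" if "x \<in> R" for x
    unfolding m_def using bdd that by (simp add: cINF_lower)
  have "\<exists>x\<in>R. Q x < m + inverse (real (Suc n))" for n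
    using cINF_less_iff[OF ne bdd, of "m + inverse (real (Suc n))"]
    unfolding m_def by simp
  then obtain x where x: "\<And>n. x n \<in> R" "\<And>n. Q (x n) < m + inverse (real (Suc n))"
    by metis
  define X where "X n = fst (x n)" for n
  define P where "P n = snd (x n)" for n
  have XP: "(X n, P n) \<in> R" for n using x(1)[of n] by (simp add: X_def P_def)
  have XV: "X n \<in> V" for n using XP RV by blast
  have Qn: "(hnorm ip (X n))\<^sup>2 - 2 * Re (P n) < m + inverse (real (Suc n))" for n
    using x(2)[of n] by (simp add: Q_def X_def P_def case_prod_beta)
  have gap: "(hnorm ip (X p - X q))\<^sup>2 \<le> 2 * (inverse (real (Suc p)) + inverse (real (Suc q)))" for p q
  proof -
    have "m \<le> Q (scale (1/2) (X p + X q), (1/2) * (P p + P q))"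
      using XP[of p] XP[of q] add scl m_le by blast
    also have "\<dots> = (1/4) * (hnorm ip (X p + X q))\<^sup>2 - Re (P p) - Re (P q)"
      by (simp add: Q_def hnorm_scale XV power_mult_distrib power_divide add_divide_distrib)
    finally have "4 * m \<le> (hnorm ip (X p + X q))\<^sup>2 - 4 * Re (P p) - 4 * Re (P q)" by simp
    moreover have "(hnorm ip (X p + X q))\<^sup>2 + (hnorm ip (X p - X q))\<^sup>2
        = 2 * (hnorm ip (X p))\<^sup>2 + 2 * (hnorm ip (X q))\<^sup>2"
      by (simp add: hnorm_add_power2 hnorm_diff_power2 XV)
    ultimately show ?thesis
      using Qn[of p] Qn[of q] by simp
  qed
  have "\<exists>N. \<forall>p\<ge>N. \<forall>q\<ge>N. hnorm ip (X p - X q) < e" if e: "e > 0" for e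
  proof -
    obtain N where N: "inverse (real (Suc N)) < e\<^sup>2 / 4"
      using e reals_Archimedean[of "e\<^sup>2 / 4"] by auto
    have "hnorm ip (X p - X q) < e" if "p \<ge> N" "q \<ge> N" for p q
    proof -
      have "inverse (real (Suc p)) \<le> inverse (real (Suc N))"
        "inverse (real (Suc q)) \<le> inverse (real (Suc N))"
        using that by (auto intro: le_imp_inverse_le)
      then have "(hnorm ip (X p - X q))\<^sup>2 < e\<^sup>2"
        using gap[of p q] N by argo
      then show ?thesis
        using e by (simp add: power2_less_imp_less)
    qed
    then show ?thesis by blast
  qed
  then obtain v where v: "v \<in> V" and lim: "(\<lambda>n. hnorm ip (X n - v)) \<longlonglongrightarrow> 0"
    using complete[of X] XV by blast
  have rep: "ip u v = \<phi>" if u: "(u, \<phi>) \<in> R" for u \<phi>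
  proof -
    have uV: "u \<in> V" using u RV by blast
    have *: "0 \<le> inverse (real (Suc n)) + 2 * Re (t * ip u (X n)) - 2 * Re (t * \<phi>)
        + (cmod t)\<^sup>2 * (hnorm ip u)\<^sup>2" for t n
    proof -
      have "m \<le> Q (X n + scale t u, P n + t * \<phi>)"
        using XP[of n] u add scl m_le by blast
      also have "\<dots> = (hnorm ip (X n))\<^sup>2 + (cmod t)\<^sup>2 * (hnorm ip u)\<^sup>2
          + 2 * Re (cnj t * ip (X n) u) - 2 * Re (P n) - 2 * Re (t * \<phi>)"
        unfolding Q_def case_prod_conv
        by (subst hnorm_add_power2)
          (simp_all add: hnorm_scale XV uV ip_scale_right power_mult_distrib)
      also have "cnj t * ip (X n) u = cnj (t * ip u (X n))"
        using ip_cnj[OF uV XV, of n] by simp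
      finally show ?thesis using Qn[of n] by (simp del: complex_cnj_mult)
    qed
    have "(\<lambda>n. cnj (ip (X n) u)) \<longlonglongrightarrow> cnj (ip v u)"
      by (intro tendsto_cnj ip_tendsto XV v uV lim)
    then have "(\<lambda>n. ip u (X n)) \<longlonglongrightarrow> ip u v"
      using ip_cnj[OF XV uV] ip_cnj[OF v uV] by simp
    then have lim2: "(\<lambda>n. inverse (real (Suc n)) + 2 * Re (t * ip u (X n)) - 2 * Re (t * \<phi>)
        + (cmod t)\<^sup>2 * (hnorm ip u)\<^sup>2) \<longlonglongrightarrow>
        0 + 2 * Re (t * ip u v) - 2 * Re (t * \<phi>) + (cmod t)\<^sup>2 * (hnorm ip u)\<^sup>2" for t
      by (intro tendsto_intros LIMSEQ_inverse_real_of_nat)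
    have key: "0 \<le> 2 * Re (t * (ip u v - \<phi>)) + (cmod t)\<^sup>2 * (hnorm ip u)\<^sup>2" for t
      using LIMSEQ_le_const[OF lim2[of t], of 0] *[where t = t] by (auto simp: algebra_simps)
    define d where "d = ip u v - \<phi>"
    define s where "s = 1 / (1 + (hnorm ip u)\<^sup>2)"
    have s0: "s > 0" by (simp add: s_def add_pos_nonneg)
    have s1: "s * (hnorm ip u)\<^sup>2 \<le> 1"
      by (simp add: s_def divide_le_eq add_pos_nonneg)
    \<comment> \<open>Test the variation in the direction \<open>- s cnj d\<close>, with \<open>s\<close> so small that the quadratic
      term cannot compensate the linear one.\<close>
    have "0 \<le> - 2 * s * (cmod d)\<^sup>2 + s\<^sup>2 * (cmod d)\<^sup>2 * (hnorm ip u)\<^sup>2"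
    proof -
      have "complex_of_real (- s) * cnj d * d = of_real (- s * (cmod d)\<^sup>2)"
        by (simp only: of_real_mult complex_norm_square mult_ac)
      then have "Re (complex_of_real (- s) * cnj d * d) = - s * (cmod d)\<^sup>2"
        by (simp only: Re_complex_of_real)
      moreover have "(cmod (complex_of_real (- s) * cnj d))\<^sup>2 = s\<^sup>2 * (cmod d)\<^sup>2"
        by (simp add: norm_mult power_mult_distrib)
      moreover have "0 \<le> 2 * Re (complex_of_real (- s) * cnj d * d) +
          (cmod (complex_of_real (- s) * cnj d))\<^sup>2 * (hnorm ip u)\<^sup>2"
        using key[of "of_real (- s) * cnj d"] by (simp only: d_def)
      ultimately show ?thesis by (simp only: mult_minus_left mult_minus_right mult.assoc)
    qed
    also have "\<dots> = s * (cmod d)\<^sup>2 * (s * (hnorm ip u)\<^sup>2 - 2)"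
      by (simp add: algebra_simps power2_eq_square)
    finally have "s * (cmod d)\<^sup>2 * (s * (hnorm ip u)\<^sup>2 - 2) \<ge> 0" .
    moreover have "s * (hnorm ip u)\<^sup>2 - 2 < 0" using s1 by simp
    ultimately have "s * (cmod d)\<^sup>2 \<le> 0"
      by (simp add: zero_le_mult_iff)
    then have "(cmod d)\<^sup>2 \<le> 0"
      using s0 by (simp add: mult_le_0_iff)
    then show ?thesis by (simp add: d_def)
  qed
  have "(hnorm ip v)\<^sup>2 \<le> M * hnorm ip v"
  proof -
    have "(\<lambda>n. ip (X n) v) \<longlonglongrightarrow> ip v v" by (intro ip_tendsto XV v lim)
    then have l1: "(\<lambda>n. Re (ip (X n) v)) \<longlonglongrightarrow> Re (ip v v)" by (intro tendsto_intros)
    have "Re (ip (X n) v) \<le> M * hnorm ip (X n - v) + M * hnorm ip v" for n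
    proof -
      have "Re (ip (X n) v) \<le> M * hnorm ip (X n)"
        using bd[OF XP, of n] rep[OF XP, of n] complex_Re_le_cmod[of "P n"] by simp
      moreover have "\<bar>hnorm ip (X n) - hnorm ip v\<bar> \<le> hnorm ip (X n - v)"
        using hnorm_triangle[of "X n - v" v] hnorm_triangle[of "v - X n" "X n"]
          hnorm_minus_commute[of v "X n"] by (simp add: XV v)
      then have "M * (hnorm ip (X n) - hnorm ip v) \<le> M * hnorm ip (X n - v)"
        using M by (intro mult_left_mono) auto
      ultimately show ?thesis by (simp add: algebra_simps)
    qed
    moreover have "(\<lambda>n. M * hnorm ip (X n - v) + M * hnorm ip v) \<longlonglongrightarrow> M * 0 + M * hnorm ip v"
      by (intro tendsto_intros lim)
    ultimately have "Re (ip v v) \<le> M * 0 + M * hnorm ip v"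
      using l1 by (meson LIMSEQ_le)
    then show ?thesis by (simp add: hnorm_power2 v)
  qed
  then have "hnorm ip v \<le> M"
    using v M hnorm_nonneg[OF v] hnorm_eq_0[OF v] mult_le_cancel_right[of "hnorm ip v" "hnorm ip v" M]
    by (cases "v = 0") (simp add: hnorm_def, simp add: power2_eq_square order_less_le)
  with v rep show thesis using that by blast
qed

text \<open>The moment problem in a Hilbert space: numbers \<open>a i\<close> are the inner products of a vector with
  the given vectors \<open>k i\<close> as soon as the functional \<open>k i \<mapsto> cnj (a i)\<close> on finite combinations is
  bounded. Membership in a reproducing kernel space, the Riesz representation and orthogonal
  projections are all instances.\<close>

lemma (in hilbert_space) moment_problem:
  assumes k: "\<And>i. i \<in> I \<Longrightarrow> k i \<in> V"
    and bd: "\<And>F c. finite F \<Longrightarrow> F \<subseteq> I \<Longrightarrow>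
      cmod (\<Sum>i\<in>F. c i * cnj (a i)) \<le> M * hnorm ip (\<Sum>i\<in>F. scale (c i) (k i))"
    and M: "M \<ge> 0"
  obtains v where "v \<in> V" "hnorm ip v \<le> M" "\<And>i. i \<in> I \<Longrightarrow> ip v (k i) = a i"
proof -
  define R where "R = {(\<Sum>i\<in>F. scale (c i) (k i), \<Sum>i\<in>F. c i * cnj (a i)) | F c. finite F \<and> F \<subseteq> I}"
  have RI: "(\<Sum>i\<in>F. scale (c i) (k i), \<Sum>i\<in>F. c i * cnj (a i)) \<in> R" if "finite F" "F \<subseteq> I" for F c
    using that unfolding R_def by blast
  have ext: "\<exists>c'. (\<Sum>i\<in>F. scale (c i) (k i)) = (\<Sum>i\<in>G. scale (c' i) (k i)) \<and>
      (\<Sum>i\<in>F. c i * cnj (a i)) = (\<Sum>i\<in>G. c' i * cnj (a i))" if "finite G" "F \<subseteq> G" for F G c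
    using that
    by (intro exI[of _ "\<lambda>i. if i \<in> F then c i else 0"] conjI)
      (auto intro!: sum.mono_neutral_cong_left)
  obtain v where v: "v \<in> V" "hnorm ip v \<le> M" "\<And>u \<phi>. (u, \<phi>) \<in> R \<Longrightarrow> ip u v = \<phi>"
  proof (rule riesz_on_graph[of R M])
    show "u \<in> V" if "(u, \<phi>) \<in> R" for u \<phi>
      using that k unfolding R_def by (auto intro!: V_sum V_scale)
    show "R \<noteq> {}"
      using RI[of "{}"] by blast
    show "(u + v, \<phi> + \<psi>) \<in> R" if uv: "(u, \<phi>) \<in> R" "(v, \<psi>) \<in> R" for u \<phi> v \<psi>
    proof -
      from uv obtain F c G d where
        F: "finite F" "F \<subseteq> I" "u = (\<Sum>i\<in>F. scale (c i) (k i))" "\<phi> = (\<Sum>i\<in>F. c i * cnj (a i))" and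
        G: "finite G" "G \<subseteq> I" "v = (\<Sum>i\<in>G. scale (d i) (k i))" "\<psi> = (\<Sum>i\<in>G. d i * cnj (a i))"
        unfolding R_def by blast
      obtain c' where c': "u = (\<Sum>i\<in>F \<union> G. scale (c' i) (k i))" "\<phi> = (\<Sum>i\<in>F \<union> G. c' i * cnj (a i))"
        using ext[of "F \<union> G" F c] F G by auto
      obtain d' where d': "v = (\<Sum>i\<in>F \<union> G. scale (d' i) (k i))" "\<psi> = (\<Sum>i\<in>F \<union> G. d' i * cnj (a i))"
        using ext[of "F \<union> G" G d] F G by auto
      show ?thesis
        using RI[of "F \<union> G" "\<lambda>i. c' i + d' i"] F G
        by (simp add: c' d' sum.distrib scale_left_distrib distrib_right)
    qed
    show "(scale c u, c * \<phi>) \<in> R" if u: "(u, \<phi>) \<in> R" for u \<phi> c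
    proof -
      from u obtain F d where
        F: "finite F" "F \<subseteq> I" "u = (\<Sum>i\<in>F. scale (d i) (k i))" "\<phi> = (\<Sum>i\<in>F. d i * cnj (a i))"
        unfolding R_def by blast
      then show ?thesis
        using RI[of F "\<lambda>i. c * d i"]
        by (simp add: scale_sum_right sum_distrib_left mult_ac)
    qed
    show "cmod \<phi> \<le> M * hnorm ip u" if "(u, \<phi>) \<in> R" for u \<phi>
      using that bd unfolding R_def by blast
  qed (use M in blast)+
  have "ip v (k i) = a i" if i: "i \<in> I" for i
  proof -
    have "ip (k i) v = cnj (a i)"
      using v(3) RI[of "{i}" "\<lambda>_. 1"] i by simp
    then show ?thesis
      using ip_cnj[OF k[OF i] v(1)] by simp
  qed
  then show thesis using that v(1,2) by blast
qed

lemma (in hilbert_space) riesz_representation: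
  assumes add: "\<And>f g. f \<in> V \<Longrightarrow> g \<in> V \<Longrightarrow> \<phi> (f + g) = \<phi> f + \<phi> g"
    and scl: "\<And>c f. f \<in> V \<Longrightarrow> \<phi> (scale c f) = c * \<phi> f"
    and bd: "\<And>f. f \<in> V \<Longrightarrow> cmod (\<phi> f) \<le> M * hnorm ip f" and M: "M \<ge> 0"
  obtains v where "v \<in> V" "hnorm ip v \<le> M" "\<And>f. f \<in> V \<Longrightarrow> ip f v = \<phi> f"
proof -
  have 0: "\<phi> 0 = 0" using add[of 0 0] by simp
  have sum: "\<phi> (\<Sum>i\<in>F. scale (c i) i) = (\<Sum>i\<in>F. c i * \<phi> i)" if "F \<subseteq> V" for F c
    using that by (induction F rule: infinite_finite_induct) (auto simp: 0 add scl V_sum subset_eq)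
  obtain v where v: "v \<in> V" "hnorm ip v \<le> M" "\<And>f. f \<in> V \<Longrightarrow> ip v f = cnj (\<phi> f)"
    by (rule moment_problem[of V "\<lambda>f. f" "\<lambda>f. cnj (\<phi> f)" M])
      (use sum bd M in \<open>auto simp: V_sum subset_eq sum[symmetric]\<close>)
  show thesis
    using that[of v] v ip_cnj[OF v(1)] by simp
qed

subsection \<open>Orthogonal complements and projections\<close>

lemma (in hilbert_space) orthocomplement_hilbert_space:
  assumes E: "E \<subseteq> V" and S: "S = {f \<in> V. \<forall>g\<in>E. ip f g = 0}"
  shows "hilbert_space scale S ip"
proof
  show "subspace S"
    unfolding subspace_def S using E by (auto simp: ip_add ip_scale subset_eq)
  fix X assume X: "\<And>n::nat. X n \<in> S"
    and "\<And>e. e > 0 \<Longrightarrow> \<exists>N. \<forall>p\<ge>N. \<forall>q\<ge>N. hnorm ip (X p - X q) < e"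
  then obtain f where f: "f \<in> V" "(\<lambda>n. hnorm ip (X n - f)) \<longlonglongrightarrow> 0"
    using complete[of X] by (auto simp: S)
  have "ip f g = 0" if g: "g \<in> E" for g
  proof -
    have "(\<lambda>n. ip (X n) g) \<longlonglongrightarrow> ip f g"
      by (rule ip_tendsto) (use X f g E in \<open>auto simp: S\<close>)
    moreover have "(\<lambda>n. ip (X n) g) = (\<lambda>n. 0)" using X g by (auto simp: S)
    ultimately show ?thesis by (simp add: LIMSEQ_const_iff)
  qed
  with f show "\<exists>f\<in>S. (\<lambda>n. hnorm ip (X n - f)) \<longlonglongrightarrow> 0" by (auto simp: S)
qed (auto simp: S ip_add ip_scale ip_pos intro: ip_cnj)

lemma (in hilbert_space) orth_proj:
  assumes S: "hilbert_space scale S ip" "S \<subseteq> V" and h: "h \<in> V"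
  shows "orth_proj ip S h \<in> S" "g \<in> S \<Longrightarrow> ip (orth_proj ip S h) g = ip h g"
    "hnorm ip (orth_proj ip S h) \<le> hnorm ip h"
    "\<lbrakk>s \<in> S; \<And>g. g \<in> S \<Longrightarrow> ip s g = ip h g\<rbrakk> \<Longrightarrow> orth_proj ip S h = s"
proof -
  interpret S: hilbert_space scale S ip by fact
  obtain v where v: "v \<in> S" "hnorm ip v \<le> hnorm ip h" "\<And>g. g \<in> S \<Longrightarrow> ip g v = ip g h"
    by (rule S.riesz_representation[of "\<lambda>g. ip g h" "hnorm ip h"])
      (use h S(2) Cauchy_Schwarz[of _ h] in \<open>auto simp: ip_add ip_scale subset_eq mult.commute\<close>)
  have v': "ip (h - v) g = 0" if "g \<in> S" for g
    using v(3)[OF that] ip_cnj[of g h] ip_cnj[of g v] v(1) that h S(2)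
    by (auto simp: ip_diff subset_eq)
  have uniq: "orth_proj ip S h = s" if s: "s \<in> S" "\<And>g. g \<in> S \<Longrightarrow> ip (h - s) g = 0" for s
    unfolding orth_proj_def
  proof (rule the_equality)
    fix t assume t: "t \<in> S \<and> (\<forall>g\<in>S. ip (h - t) g = 0)"
    have ts: "t - s \<in> S" using t s by simp
    then have "ip (h - s) (t - s) = 0" "ip (h - t) (t - s) = 0"
      using s t by auto
    moreover have "ip (t - s) (t - s) = ip (h - s) (t - s) - ip (h - t) (t - s)"
      using t s ts h S(2) by (subst ip_diff[symmetric]) auto
    ultimately show "t = s" using S.ip_pos[OF ts] by auto
  qed (use s in auto)
  note P = uniq[OF v(1) v']
  show "orth_proj ip S h \<in> S" "hnorm ip (orth_proj ip S h) \<le> hnorm ip h"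
    "g \<in> S \<Longrightarrow> ip (orth_proj ip S h) g = ip h g"
    using P v v'[of g] h S(2) by (auto simp: ip_diff subset_eq)
  show "orth_proj ip S h = s" if "s \<in> S" "\<And>g. g \<in> S \<Longrightarrow> ip s g = ip h g"
    using that h S(2) by (intro uniq) (auto simp: ip_diff subset_eq)
qed

subsection \<open>Unitary maps\<close>

lemma vector_space_vfscale: "vector_space vfscale"
  by standard (auto simp: vfscale_def fun_eq_iff vec_eq_iff algebra_simps)

text \<open>Two total families with the same Gram matrix are intertwined by a unitary. Here the unitary is
  known in advance as a map \<open>U\<close> that is compatible with the moments.\<close>

lemma unitary_of_equal_gram:
  assumes "hilbert_space s V ip" "hilbert_space s' V' ip'"
    and k: "\<And>i. i \<in> I \<Longrightarrow> k i \<in> V" and k': "\<And>i. i \<in> I \<Longrightarrow> k' i \<in> V'"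
    and gram: "\<And>i j. i \<in> I \<Longrightarrow> j \<in> I \<Longrightarrow> ip (k i) (k j) = ip' (k' i) (k' j)"
    and total: "\<And>f. f \<in> V \<Longrightarrow> (\<And>i. i \<in> I \<Longrightarrow> ip f (k i) = 0) \<Longrightarrow> f = 0"
    and U: "\<And>f g. f \<in> V \<Longrightarrow> g \<in> V' \<Longrightarrow> (\<And>i. i \<in> I \<Longrightarrow> ip' g (k' i) = ip f (k i)) \<Longrightarrow> U f = g"
  shows "linear_betw s V s' V' U" "bij_betw U V V'"
    "\<And>f g. f \<in> V \<Longrightarrow> g \<in> V \<Longrightarrow> ip' (U f) (U g) = ip f g"
proof -
  interpret V: hilbert_space s V ip by fact
  interpret V': hilbert_space s' V' ip' by fact
  have norms: "hnorm ip (\<Sum>i\<in>F. s (c i) (k i)) = hnorm ip' (\<Sum>i\<in>F. s' (c i) (k' i))"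
    if "F \<subseteq> I" for F c
  proof -
    have "(\<Sum>i\<in>F. \<Sum>j\<in>F. cnj (c i) * c j * ip (k j) (k i)) =
      (\<Sum>i\<in>F. \<Sum>j\<in>F. cnj (c i) * c j * ip' (k' j) (k' i))"
      using that gram by (intro sum.cong) (auto simp: subset_eq)
    moreover have "complex_of_real ((hnorm ip (\<Sum>i\<in>F. s (c i) (k i)))\<^sup>2) =
      (\<Sum>i\<in>F. \<Sum>j\<in>F. cnj (c i) * c j * ip (k j) (k i))"
      by (rule V.hnorm_combination_power2) (use that k in auto)
    moreover have "complex_of_real ((hnorm ip' (\<Sum>i\<in>F. s' (c i) (k' i)))\<^sup>2) =
      (\<Sum>i\<in>F. \<Sum>j\<in>F. cnj (c i) * c j * ip' (k' j) (k' i))"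
      by (rule V'.hnorm_combination_power2) (use that k' in auto)
    ultimately have "(hnorm ip (\<Sum>i\<in>F. s (c i) (k i)))\<^sup>2 = (hnorm ip' (\<Sum>i\<in>F. s' (c i) (k' i)))\<^sup>2"
      by (metis of_real_eq_iff)
    moreover have "(\<Sum>i\<in>F. s (c i) (k i)) \<in> V" "(\<Sum>i\<in>F. s' (c i) (k' i)) \<in> V'"
      using that k k' by (auto intro!: V.V_sum V'.V_sum)
    ultimately show ?thesis by simp
  qed
  have push: "\<exists>g\<in>V'. hnorm ip' g \<le> hnorm ip f \<and> (\<forall>i\<in>I. ip' g (k' i) = ip f (k i))" if f: "f \<in> V" for f
  proof (rule V'.moment_problem[of I k' "\<lambda>i. ip f (k i)" "hnorm ip f"])
    fix F c assume F: "finite F" "F \<subseteq> I"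
    have "(\<Sum>i\<in>F. c i * cnj (ip f (k i))) = ip (\<Sum>i\<in>F. s (c i) (k i)) f"
      using F k V.ip_cnj[OF f, symmetric] by (subst V.ip_sum) (auto intro!: sum.cong simp: V.ip_scale subset_eq f)
    also have "cmod \<dots> \<le> hnorm ip (\<Sum>i\<in>F. s (c i) (k i)) * hnorm ip f"
      using F k f by (intro V.Cauchy_Schwarz V.V_sum) auto
    finally show "cmod (\<Sum>i\<in>F. c i * cnj (ip f (k i))) \<le> hnorm ip f * hnorm ip' (\<Sum>i\<in>F. s' (c i) (k' i))"
      using norms[OF F(2)] by (simp add: mult.commute)
  qed (use k' f in auto)
  have pull: "\<exists>f\<in>V. hnorm ip f \<le> hnorm ip' g \<and> (\<forall>i\<in>I. ip f (k i) = ip' g (k' i))" if g: "g \<in> V'" for g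
  proof (rule V.moment_problem[of I k "\<lambda>i. ip' g (k' i)" "hnorm ip' g"])
    fix F c assume F: "finite F" "F \<subseteq> I"
    have "(\<Sum>i\<in>F. c i * cnj (ip' g (k' i))) = ip' (\<Sum>i\<in>F. s' (c i) (k' i)) g"
      using F k' V'.ip_cnj[OF g, symmetric] by (subst V'.ip_sum) (auto intro!: sum.cong simp: V'.ip_scale subset_eq g)
    also have "cmod \<dots> \<le> hnorm ip' (\<Sum>i\<in>F. s' (c i) (k' i)) * hnorm ip' g"
      using F k' g by (intro V'.Cauchy_Schwarz V'.V_sum) auto
    finally show "cmod (\<Sum>i\<in>F. c i * cnj (ip' g (k' i))) \<le> hnorm ip' g * hnorm ip (\<Sum>i\<in>F. s (c i) (k i))"
      using norms[OF F(2)] by (simp add: mult.commute)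
  qed (use k g in auto)
  have eqV: "f = f'" if "f \<in> V" "f' \<in> V" "\<And>i. i \<in> I \<Longrightarrow> ip f (k i) = ip f' (k i)" for f f'
    using total[of "f - f'"] that k by (simp add: V.ip_diff)
  have UV: "U f \<in> V' \<and> hnorm ip' (U f) \<le> hnorm ip f \<and> (\<forall>i\<in>I. ip' (U f) (k' i) = ip f (k i))"
    if "f \<in> V" for f
    using push[OF that] U[OF that] by metis
  show lin: "linear_betw s V s' V' U"
    unfolding linear_betw_def
  proof (intro conjI ballI allI)
    show "U ` V \<subseteq> V'" using UV by blast
    show "U (f + g) = U f + U g" if "f \<in> V" "g \<in> V" for f g
      by (rule U) (use that UV k k' in \<open>auto simp: V.ip_add V'.ip_add\<close>)
    show "U (s c f) = s' c (U f)" if "f \<in> V" for c f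
      by (rule U) (use that UV k k' in \<open>auto simp: V.ip_scale V'.ip_scale\<close>)
  qed
  have ex: "\<exists>f\<in>V. U f = g \<and> hnorm ip f \<le> hnorm ip' g" if "g \<in> V'" for g
    using pull[OF that] U[OF _ that] by metis
  have inj: "inj_on U V"
    by (rule inj_onI, rule eqV) (use UV in \<open>auto, metis\<close>)
  show "bij_betw U V V'"
    unfolding bij_betw_def using inj UV ex by blast
  have "hnorm ip' (U f) = hnorm ip f" if "f \<in> V" for f
    using ex[of "U f"] UV[OF that] inj that by (metis inj_on_eq_iff order_antisym)
  then show "ip' (U f) (U g) = ip f g" if "f \<in> V" "g \<in> V" for f g
    using V.polarization_eq[OF \<open>hilbert_space s' V' ip'\<close> lin] that by blast
qed

text \<open>This is how a space with a prescribed reproducing kernel is produced: as an image of a closed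
  subspace that is already at hand.\<close>

lemma hilbert_space_transport:
  assumes "hilbert_space s V ip" "vector_space s'"
    and lin: "linear_betw s V s' UNIV U" and inj: "inj_on U V"
  shows "hilbert_space s' (U ` V) (\<lambda>f g. ip (inv_into V U f) (inv_into V U g))"
proof -
  interpret V: hilbert_space s V ip by fact
  interpret s': vector_space s' by fact
  note inv [simp] = inv_into_f_f[OF inj]
  have add: "U f + U g = U (f + g)" if "f \<in> V" "g \<in> V" for f g
    using lin that by (simp add: linear_betw_def)
  have scl: "s' c (U f) = U (s c f)" if "f \<in> V" for f c
    using lin that by (simp add: linear_betw_def)
  have zero: "U 0 = 0" using add[of 0 0] by simp
  have diff: "U f - U g = U (f - g)" if "f \<in> V" "g \<in> V" for f g
    using add[of "f - g" g] that by (simp add: algebra_simps)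
  show ?thesis
  proof
    show "s'.subspace (U ` V)"
      unfolding s'.subspace_def using zero[symmetric] by (auto simp: add scl)
    show "0 < Re (ip (inv_into V U f) (inv_into V U f))" if "f \<in> U ` V" "f \<noteq> 0" for f
      using that zero by (auto intro!: V.ip_pos)
    fix X assume X: "\<And>n::nat. X n \<in> U ` V"
      and C: "\<And>e. e > 0 \<Longrightarrow> \<exists>N. \<forall>p\<ge>N. \<forall>q\<ge>N.
        hnorm (\<lambda>f g. ip (inv_into V U f) (inv_into V U g)) (X p - X q) < e"
    define Y where "Y n = inv_into V U (X n)" for n
    have Y: "Y n \<in> V" "X n = U (Y n)" for n
      using X[of n] by (auto simp: Y_def inv_into_into f_inv_into_f)
    have "\<exists>N. \<forall>p\<ge>N. \<forall>q\<ge>N. hnorm ip (Y p - Y q) < e" if "e > 0" for e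
      using C[OF that] by (simp add: hnorm_def Y diff)
    then obtain f where "f \<in> V" "(\<lambda>n. hnorm ip (Y n - f)) \<longlonglongrightarrow> 0"
      using V.complete[of Y] Y by blast
    then show "\<exists>f\<in>U ` V. (\<lambda>n. hnorm (\<lambda>f g. ip (inv_into V U f) (inv_into V U g)) (X n - f)) \<longlonglongrightarrow> 0"
      by (intro bexI[of _ "U f"]) (auto simp: hnorm_def Y diff)
  qed (auto simp: add scl V.ip_add V.ip_scale intro: V.ip_cnj)
qed

section \<open>Holomorphic functions of several variables\<close>

lemma norm_vector_smult: "norm (c *s (x :: complex^'n)) = cmod c * norm x"
  by (simp add: norm_vec_def L2_set_right_distrib norm_mult)

lemma axis_smult: "axis i c = c *s (axis i 1 :: complex^'n)"
  by (simp add: vec_eq_iff axis_def)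

lemma axis_0 [simp]: "axis i 0 = (0 :: complex^'n)"
  by (simp add: vec_eq_iff axis_def)

lemma norm_axis_complex [simp]: "norm (axis i c :: complex^'n) = cmod c"
  by (simp add: norm_vec_def L2_set_def axis_def if_distrib[of norm] if_distrib[of "\<lambda>x. x\<^sup>2"] cong: if_cong)

lemma has_derivative_line: "((\<lambda>t. x + t *s v) has_derivative (\<lambda>t. t *s v)) (at (t::complex))"
  for x v :: "complex^'n"
proof -
  have "linear (\<lambda>t::complex. t *s v)"
    by (rule linearI) (auto simp: vec_eq_iff algebra_simps)
  then have "bounded_linear (\<lambda>t::complex. t *s v)"
    by (simp add: linear_conv_bounded_linear)
  then show ?thesis
    by (auto intro!: derivative_eq_intros bounded_linear_imp_has_derivative)
qed

lemma holomorphic_sev_frechet: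
  assumes "holomorphic_sev f S" "x \<in> S"
  shows "(f has_derivative frechet_derivative f (at x)) (at x)"
    "frechet_derivative f (at x) (c *s v) = c * frechet_derivative f (at x) v"
proof -
  obtain D where "(f has_derivative D) (at x)" "\<And>c v. D (c *s v) = c * D v"
    using assms unfolding holomorphic_sev_def by blast
  moreover from this(1) have "D = frechet_derivative f (at x)"
    by (rule frechet_derivative_at)
  ultimately show "(f has_derivative frechet_derivative f (at x)) (at x)"
    "frechet_derivative f (at x) (c *s v) = c * frechet_derivative f (at x) v"
    by simp_all
qed

lemma holomorphic_sev_line:
  assumes "holomorphic_sev f S" "x + t *s v \<in> S"
  shows "((\<lambda>t. f (x + t *s v)) has_field_derivative frechet_derivative f (at (x + t *s v)) v) (at t)"
proof -
  have "((\<lambda>t. f (x + t *s v)) has_derivative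
      (\<lambda>s. frechet_derivative f (at (x + t *s v)) (s *s v))) (at t)"
    using has_derivative_compose[OF has_derivative_line[of x v t] holomorphic_sev_frechet(1)[OF assms]]
    by simp
  then show ?thesis
    by (simp add: has_field_derivative_def holomorphic_sev_frechet(2)[OF assms] mult.commute[of _ "frechet_derivative f (at (x + t *s v)) v"])
qed

lemma holomorphic_sev_axis:
  fixes x :: "complex^'n"
  assumes "holomorphic_sev f S" "x + axis i t \<in> S"
  shows "((\<lambda>t. f (x + axis i t)) has_field_derivative pderiv_hol i f (x + axis i t)) (at t)"
proof -
  note ax = axis_smult[of i]
  let ?D = "frechet_derivative f (at (x + axis i t)) (axis i 1)"
  have *: "((\<lambda>t. f (x + axis i t)) has_field_derivative ?D) (at t)"
    using holomorphic_sev_line[of f S x t "axis i 1"] assms by (simp flip: ax)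
  have "((\<lambda>s. f (x + axis i t + axis i s)) has_field_derivative ?D) (at 0)"
    using holomorphic_sev_line[of f S "x + axis i t" 0 "axis i 1"] assms by (simp flip: ax)
  then have "pderiv_hol i f (x + axis i t) = ?D"
    by (simp add: pderiv_hol_def DERIV_imp_deriv)
  with * show ?thesis by simp
qed

lemma pderiv_hol_frechet:
  assumes "holomorphic_sev f S" "x \<in> S"
  shows "pderiv_hol i f x = frechet_derivative f (at x) (axis i 1)"
proof -
  have "((\<lambda>s. f (x + s *s axis i 1)) has_field_derivative frechet_derivative f (at x) (axis i 1)) (at 0)"
    using holomorphic_sev_line[of f S x 0 "axis i 1"] assms by simp
  then show ?thesis
    by (simp add: pderiv_hol_def DERIV_imp_deriv flip: axis_smult)
qed

lemma holomorphic_sev_pderiv_at: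
  assumes "holomorphic_sev f S" "x \<in> S"
  shows "((\<lambda>t. f (x + axis i t)) has_field_derivative pderiv_hol i f x) (at 0)"
proof -
  show ?thesis using holomorphic_sev_axis[of f S x i 0] assms by simp
qed

lemma holomorphic_sev_continuous_on: "holomorphic_sev f S \<Longrightarrow> continuous_on S f"
  by (meson continuous_at_imp_continuous_on has_derivative_continuous holomorphic_sev_frechet(1))

lemma holomorphic_sev_subset: "holomorphic_sev f S \<Longrightarrow> U \<subseteq> S \<Longrightarrow> holomorphic_sev f U"
  unfolding holomorphic_sev_def by blast

lemma holomorphic_sev_compose:
  assumes f: "holomorphic_sev f S"
    and A: "\<And>x. x \<in> U \<Longrightarrow> A x \<in> S"
      "\<And>x. x \<in> U \<Longrightarrow> (A has_derivative L) (at x)" "\<And>c v. L (c *s v) = c *s L v"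
  shows "holomorphic_sev (\<lambda>x. f (A x)) U"
  unfolding holomorphic_sev_def
proof
  fix x assume x: "x \<in> U"
  show "\<exists>D. ((\<lambda>x. f (A x)) has_derivative D) (at x) \<and> (\<forall>c v. D (c *s v) = c * D v)"
    using has_derivative_compose[OF A(2)[OF x] holomorphic_sev_frechet(1)[OF f A(1)[OF x]]]
    by (auto simp: A(3) holomorphic_sev_frechet(2)[OF f A(1)[OF x]] intro!: exI)
qed

lemma holomorphic_sev_diff:
  assumes "holomorphic_sev f S" "holomorphic_sev g S"
  shows "holomorphic_sev (\<lambda>x. f x - g x) S"
  unfolding holomorphic_sev_def
proof
  fix x assume x: "x \<in> S"
  show "\<exists>D. ((\<lambda>x. f x - g x) has_derivative D) (at x) \<and> (\<forall>c v. D (c *s v) = c * D v)"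
    using has_derivative_diff[OF holomorphic_sev_frechet(1)[OF assms(1) x] holomorphic_sev_frechet(1)[OF assms(2) x]]
    by (intro exI conjI, assumption)
      (auto simp: holomorphic_sev_frechet(2)[OF assms(1) x] holomorphic_sev_frechet(2)[OF assms(2) x] algebra_simps)
qed

lemma holomorphic_sev_cmult:
  assumes "holomorphic_sev f S"
  shows "holomorphic_sev (\<lambda>x. a * f x) S"
  unfolding holomorphic_sev_def
proof
  fix x assume x: "x \<in> S"
  show "\<exists>D. ((\<lambda>x. a * f x) has_derivative D) (at x) \<and> (\<forall>c v. D (c *s v) = c * D v)"
    using has_derivative_mult_right[OF holomorphic_sev_frechet(1)[OF assms(1) x], of a]
    by (intro exI conjI, assumption) (auto simp: holomorphic_sev_frechet(2)[OF assms(1) x] algebra_simps)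
qed

lemma holomorphic_sev_cong:
  assumes "holomorphic_sev f S" "open S" "\<And>x. x \<in> S \<Longrightarrow> g x = f x"
  shows "holomorphic_sev g S"
  unfolding holomorphic_sev_def
proof
  fix x assume x: "x \<in> S"
  show "\<exists>D. (g has_derivative D) (at x) \<and> (\<forall>c v. D (c *s v) = c * D v)"
    using has_derivative_transform_within_open[OF holomorphic_sev_frechet(1)[OF assms(1) x] assms(2) x]
      assms(3) holomorphic_sev_frechet(2)[OF assms(1) x] by metis
qed

lemma pderiv_hol_cong:
  fixes x :: "complex^'n"
  assumes "open S" "x \<in> S" "\<And>y. y \<in> S \<Longrightarrow> f y = g y"
  shows "pderiv_hol i f x = pderiv_hol i g x"
proof -
  have ax: "(\<lambda>t. x + axis i t) = (\<lambda>t. x + t *s axis i 1)" by (simp flip: axis_smult)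
  have "((\<lambda>t. x + axis i t) \<longlongrightarrow> x) (at 0)"
    unfolding ax using has_derivative_continuous[OF has_derivative_line[of x "axis i 1" 0]]
    by (simp add: continuous_within)
  then have "eventually (\<lambda>t. x + axis i t \<in> S) (nhds 0)"
    using assms(1,2) topological_tendstoD[of "\<lambda>t. x + axis i t" x "at 0" S]
    by (simp add: eventually_nhds_conv_at)
  then have "eventually (\<lambda>t. f (x + axis i t) = g (x + axis i t)) (nhds 0)"
    by eventually_elim (use assms in auto)
  then show ?thesis
    unfolding pderiv_hol_def by (rule deriv_cong_ev) simp
qed

text \<open>The derivative along a unit vector is the derivative of a function of one complex variable, to
  which the Cauchy estimate applies.\<close>

lemma Cauchy_estimate_frechet:
  assumes f: "holomorphic_sev f S" and r: "r > 0" and sub: "cball x r \<subseteq> S"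
    and B: "\<And>y. y \<in> cball x r \<Longrightarrow> cmod (f y) \<le> B"
  shows "cmod (frechet_derivative f (at x) v) \<le> B / r * norm v"
proof (cases "v = 0")
  case True
  have "x \<in> S" using r sub by auto
  then have "frechet_derivative f (at x) (0 *s v) = 0"
    using holomorphic_sev_frechet(2)[OF f, of x 0 v] by simp
  then show ?thesis using True by simp
next
  case False
  define u where "u = (1 / complex_of_real (norm v)) *s v"
  have u: "norm u = 1" using False by (simp add: u_def norm_vector_smult norm_divide)
  have v: "v = complex_of_real (norm v) *s u" using False by (simp add: u_def vec_eq_iff)
  define g where "g t = f (x + t *s u)" for t
  have mem: "x + t *s u \<in> cball x r" if "cmod t \<le> r" for t
    using that by (simp add: dist_norm norm_vector_smult u)
  have der: "(g has_field_derivative frechet_derivative f (at (x + t *s u)) u) (at t)"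
    if "t \<in> cball 0 r" for t
    unfolding g_def using that mem sub by (intro holomorphic_sev_line[OF f]) auto
  have hol: "g holomorphic_on cball 0 r"
    by (rule holomorphic_onI) (meson der field_differentiable_def field_differentiable_at_within)
  have "cmod ((deriv ^^ 1) g 0) \<le> fact 1 * B / r ^ 1"
  proof (rule Cauchy_inequality)
    show "g holomorphic_on ball 0 r" using hol ball_subset_cball holomorphic_on_subset by blast
    show "continuous_on (cball 0 r) g" using hol by (rule holomorphic_on_imp_continuous_on)
    show "cmod (g t) \<le> B" if "cmod (0 - t) = r" for t
      unfolding g_def by (rule B, rule mem) (use that in simp)
  qed fact
  moreover have "deriv g 0 = frechet_derivative f (at x) u"
    using der[of 0] r by (intro DERIV_imp_deriv) simp
  ultimately have "cmod (frechet_derivative f (at x) u) \<le> B / r" by simp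
  then have "norm v * cmod (frechet_derivative f (at x) u) \<le> norm v * (B / r)"
    by (intro mult_left_mono) auto
  moreover have "x \<in> S" using r sub by auto
  ultimately show ?thesis
    using holomorphic_sev_frechet(2)[OF f, of x "of_real (norm v)" u] unfolding v[symmetric]
    by (simp add: norm_mult mult.commute)
qed

text \<open>By the Cauchy estimate the Frechet derivatives of a uniformly convergent sequence converge
  locally uniformly as well, so the limit is differentiable.\<close>

lemma holomorphic_sev_uniform_limit:
  fixes f :: "nat \<Rightarrow> complex^'n \<Rightarrow> complex"
  assumes S: "open S" and f: "\<And>n. holomorphic_sev (f n) S" and lim: "uniform_limit S f g sequentially"
  shows "holomorphic_sev g S"
  unfolding holomorphic_sev_def
proof
  fix x assume x: "x \<in> S"
  obtain e where e: "e > 0" "cball x e \<subseteq> S"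
    using S x open_contains_cball by blast
  define r where "r = e / 2"
  have r: "r > 0" using e by (simp add: r_def)
  have sub: "cball y r \<subseteq> S" if "y \<in> ball x r" for y
  proof
    fix z assume "z \<in> cball y r"
    then have "dist x z \<le> e" using that dist_triangle[of x z y] by (auto simp: r_def)
    then show "z \<in> S" using e by auto
  qed
  let ?D = "\<lambda>n y. frechet_derivative (f n) (at y)"
  have diff: "cmod (?D n y h - ?D m y h) \<le> B / r * norm h"
    if y: "y \<in> ball x r" and B: "\<And>z. z \<in> S \<Longrightarrow> cmod (f n z - f m z) \<le> B" for n m y h B
  proof -
    have yS: "y \<in> S" using sub[OF y] r by auto
    have "frechet_derivative (\<lambda>z. f n z - f m z) (at y) = (\<lambda>h. ?D n y h - ?D m y h)"
      using has_derivative_diff[OF holomorphic_sev_frechet(1)[OF f yS] holomorphic_sev_frechet(1)[OF f yS]]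
      by (metis frechet_derivative_at)
    moreover have "cmod (frechet_derivative (\<lambda>z. f n z - f m z) (at y) h) \<le> B / r * norm h"
      by (rule Cauchy_estimate_frechet[OF holomorphic_sev_diff[OF f f] r sub[OF y]])
        (use B sub[OF y] in auto)
    ultimately show ?thesis by simp
  qed
  have ev: "\<exists>N. \<forall>n\<ge>N. \<forall>m\<ge>N. \<forall>y\<in>ball x r. \<forall>h. cmod (?D n y h - ?D m y h) \<le> d * norm h"
    if d: "d > 0" for d
  proof -
    have "\<forall>\<^sub>F n in sequentially. \<forall>z\<in>S. dist (f n z) (g z) < d * r / 2"
      using uniform_limitD[OF lim, of "d * r / 2"] d r by simp
    then obtain N where N: "\<And>n z. n \<ge> N \<Longrightarrow> z \<in> S \<Longrightarrow> dist (f n z) (g z) < d * r / 2"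
      by (auto simp: eventually_sequentially)
    have "cmod (?D n y h - ?D m y h) \<le> d * norm h" if "n \<ge> N" "m \<ge> N" "y \<in> ball x r" for n m y h
    proof -
      have "cmod (f n z - f m z) \<le> d * r" if "z \<in> S" for z
        using N[OF \<open>n \<ge> N\<close> that] N[OF \<open>m \<ge> N\<close> that]
        by (metis add.commute dist_commute dist_norm dist_triangle_half_l less_imp_le)
      from diff[OF \<open>y \<in> ball x r\<close> this, of h] r show ?thesis by simp
    qed
    then show ?thesis by blast
  qed
  define g' where "g' y h = lim (\<lambda>n. ?D n y h)" for y h
  have g': "(\<lambda>n. ?D n y h) \<longlonglongrightarrow> g' y h" if y: "y \<in> ball x r" for y h
  proof -
    have "Cauchy (\<lambda>n. ?D n y h)"
    proof (rule CauchyI)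
      fix d :: real assume d: "d > 0"
      define d' where "d' = d / (norm h + 1)"
      have d': "d' > 0" using d by (simp add: d'_def add_nonneg_pos)
      have "d' * norm h < d' * (norm h + 1)" using d' by simp
      also have "\<dots> = d" by (simp add: d'_def) (smt (verit) norm_ge_zero)
      finally have lt: "d' * norm h < d" .
      obtain N where "\<forall>n\<ge>N. \<forall>m\<ge>N. \<forall>y\<in>ball x r. \<forall>h. cmod (?D n y h - ?D m y h) \<le> d' * norm h"
        using ev[OF d'] by blast
      then show "\<exists>M. \<forall>m\<ge>M. \<forall>n\<ge>M. cmod (?D m y h - ?D n y h) < d"
        using y lt by (meson order_le_less_trans)
    qed
    then show ?thesis
      unfolding g'_def by (simp add: Cauchy_convergent convergent_LIMSEQ_iff[symmetric])
  qed
  have "\<exists>g0. \<forall>y\<in>ball x r. (\<lambda>n. f n y) \<longlonglongrightarrow> g0 y \<and> (g0 has_derivative g' y) (at y within ball x r)"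
  proof (rule has_derivative_sequence)
    show "(f n has_derivative ?D n y) (at y within ball x r)" if "y \<in> ball x r" for n y
    proof -
      have "y \<in> S" using sub[OF that] r by auto
      then show ?thesis
        by (rule has_derivative_at_withinI[OF holomorphic_sev_frechet(1)[OF f]])
    qed
    show "\<forall>\<^sub>F n in sequentially. \<forall>y\<in>ball x r. \<forall>h. cmod (?D n y h - g' y h) \<le> d * norm h"
      if d: "d > 0" for d
    proof -
      obtain N where N: "\<And>n m y h. n \<ge> N \<Longrightarrow> m \<ge> N \<Longrightarrow> y \<in> ball x r \<Longrightarrow>
          cmod (?D n y h - ?D m y h) \<le> d * norm h"
        using ev[OF d] by blast
      have "cmod (?D n y h - g' y h) \<le> d * norm h" if "n \<ge> N" "y \<in> ball x r" for n y h
      proof (rule LIMSEQ_le_const2)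
        show "(\<lambda>m. cmod (?D n y h - ?D m y h)) \<longlonglongrightarrow> cmod (?D n y h - g' y h)"
          by (intro tendsto_intros g' that)
        show "\<exists>N. \<forall>m\<ge>N. cmod (?D n y h - ?D m y h) \<le> d * norm h"
          using N that by blast
      qed
      then show ?thesis unfolding eventually_sequentially by blast
    qed
    show "(\<lambda>n. f n x) \<longlonglongrightarrow> g x"
      using tendsto_uniform_limitI[OF lim x] .
    show "x \<in> ball x r" using r by simp
  qed simp
  then obtain g0 where g0: "\<And>y. y \<in> ball x r \<Longrightarrow> (\<lambda>n. f n y) \<longlonglongrightarrow> g0 y"
    "\<And>y. y \<in> ball x r \<Longrightarrow> (g0 has_derivative g' y) (at y within ball x r)" by blast
  have "g0 y = g y" if "y \<in> ball x r" for y
  proof -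
    have "y \<in> S" using sub[OF that] r by auto
    then show ?thesis
      using LIMSEQ_unique[OF g0(1)[OF that] tendsto_uniform_limitI[OF lim]] by blast
  qed
  moreover have "(g0 has_derivative g' x) (at x)"
  proof -
    have x: "x \<in> ball x r" using r by simp
    show ?thesis using g0(2)[OF x] unfolding at_within_open[OF x open_ball] .
  qed
  ultimately have "(g has_derivative g' x) (at x)"
    using r by (intro has_derivative_transform_within_open[of g0 "g' x" x UNIV "ball x r" g]) auto
  moreover have "g' x (c *s v) = c * g' x v" for c v
  proof -
    have "(\<lambda>n. c * ?D n x v) \<longlonglongrightarrow> c * g' x v"
      using r by (intro tendsto_mult_left g') simp
    then show ?thesis
      using LIMSEQ_unique[OF g'[of x "c *s v"]] r by (simp add: holomorphic_sev_frechet(2)[OF f x])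
  qed
  ultimately show "\<exists>D. (g has_derivative D) (at x) \<and> (\<forall>c v. D (c *s v) = c * D v)"
    by blast
qed

text \<open>The second order Taylor bound makes the convergence of difference quotients locally uniform.\<close>

lemma difference_quotient_bound:
  assumes f: "holomorphic_sev f S" and r: "r > 0"
    and sub: "cball y (2 * r) \<subseteq> S" and B: "\<And>z. z \<in> cball y (2 * r) \<Longrightarrow> cmod (f z) \<le> B"
    and h: "h \<noteq> 0" "cmod h < r"
  shows "cmod ((f (y + axis i h) - f y) / h - pderiv_hol i f y) \<le> 2 * B / r\<^sup>2 * cmod h"
proof -
  define g where "g t = f (y + axis i t)" for t
  have mem: "y + axis i t \<in> cball y (2 * r)" if "cmod t \<le> 2 * r" for t
    using that by (simp add: dist_norm)
  have hol: "g holomorphic_on ball 0 (2 * r)"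
  proof (rule holomorphic_onI)
    fix t :: complex assume "t \<in> ball 0 (2 * r)"
    then have "y + axis i t \<in> S" using mem[of t] sub by auto
    from holomorphic_sev_axis[OF f this]
    show "g field_differentiable at t within ball 0 (2 * r)"
      unfolding g_def by (meson field_differentiable_def field_differentiable_at_within)
  qed
  have "cmod ((deriv ^^ 0) g h - (\<Sum>k\<le>1. (deriv ^^ k) g 0 * (h - 0) ^ k / fact k))
      \<le> 2 * B / r\<^sup>2 * cmod (h - 0) ^ Suc 1 / fact 1"
  proof (rule field_Taylor[where S = "ball 0 r"])
    show "((deriv ^^ k) g has_field_derivative (deriv ^^ Suc k) g t) (at t within ball 0 r)"
      if "t \<in> ball 0 r" for k t
      using holomorphic_derivI[OF holomorphic_higher_deriv[OF hol], of t k "ball 0 r"] that r by simp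
    show "cmod ((deriv ^^ Suc 1) g t) \<le> 2 * B / r\<^sup>2" if t: "t \<in> ball 0 r" for t
    proof -
      have sub2: "cball t r \<subseteq> ball 0 (2 * r)"
      proof
        fix s assume "s \<in> cball t r"
        then show "s \<in> ball 0 (2 * r)"
          using t norm_triangle_ineq4[of t "t - s"] by (simp add: dist_norm)
      qed
      have "cmod ((deriv ^^ 2) g t) \<le> fact 2 * B / r ^ 2"
      proof (rule Cauchy_inequality)
        show "g holomorphic_on ball t r"
          using hol sub2 ball_subset_cball holomorphic_on_subset by blast
        show "continuous_on (cball t r) g"
          using hol sub2 holomorphic_on_imp_continuous_on holomorphic_on_subset by blast
        show "cmod (g s) \<le> B" if "cmod (t - s) = r" for s
          unfolding g_def
          by (rule B, rule mem) (use that sub2 in \<open>force simp: dist_norm subset_eq\<close>)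
      qed fact
      then show ?thesis by (simp add: numeral_2_eq_2)
    qed
  qed (use r h in auto)
  then have "cmod (g h - (g 0 + deriv g 0 * h)) \<le> 2 * B / r\<^sup>2 * (cmod h * cmod h)"
    by simp
  moreover have "deriv g 0 = pderiv_hol i f y"
    by (simp add: g_def[abs_def] pderiv_hol_def)
  ultimately have "cmod (f (y + axis i h) - f y - pderiv_hol i f y * h) / cmod h \<le> 2 * B / r\<^sup>2 * cmod h"
    using h by (simp add: g_def field_simps)
  moreover have "(f (y + axis i h) - f y) / h - pderiv_hol i f y
      = (f (y + axis i h) - f y - pderiv_hol i f y * h) / h"
    using h by (simp add: field_simps)
  ultimately show ?thesis by (simp add: norm_divide)
qed

text \<open>A partial derivative is the locally uniform limit of difference quotients, which are holomorphic.
  This gives joint differentiability of the derivative without iterated integral formulas.\<close>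

lemma holomorphic_sev_pderiv_hol:
  fixes f :: "complex^'n \<Rightarrow> complex"
  assumes S: "open S" and f: "holomorphic_sev f S"
  shows "holomorphic_sev (pderiv_hol i f) S"
proof -
  have "\<exists>U. x \<in> U \<and> holomorphic_sev (pderiv_hol i f) U" if x: "x \<in> S" for x
  proof -
    obtain e where e: "e > 0" "cball x e \<subseteq> S"
      using S x open_contains_cball by blast
    define r where "r = e / 3"
    have r: "r > 0" using e by (simp add: r_def)
    have "bounded (f ` cball x e)"
      by (intro compact_imp_bounded compact_continuous_image)
        (use holomorphic_sev_continuous_on[OF f] e continuous_on_subset in auto)
    then obtain B where B: "\<And>z. z \<in> cball x e \<Longrightarrow> cmod (f z) \<le> B"
      unfolding bounded_iff by blast
    have B0: "B \<ge> 0" using order_trans[OF norm_ge_zero B[of x]] e by simp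
    have sub: "cball y (2 * r) \<subseteq> cball x e" if "y \<in> ball x r" for y
    proof
      fix z assume "z \<in> cball y (2 * r)"
      then show "z \<in> cball x e" using that dist_triangle[of x z y] by (auto simp: r_def)
    qed
    define h where "h n = complex_of_real (r / (real n + 2))" for n :: nat
    have h: "h n \<noteq> 0" "cmod (h n) < r" for n
    proof -
      have "r * 1 < r * (real n + 2)" using r by (intro mult_strict_left_mono) auto
      then have *: "0 < r / (real n + 2)" "r / (real n + 2) < r"
        using r by (auto simp: divide_less_eq add_nonneg_pos)
      then show "h n \<noteq> 0" "cmod (h n) < r"
        unfolding h_def norm_of_real of_real_eq_0_iff by linarith+
    qed
    have h0: "(\<lambda>n. cmod (h n)) \<longlonglongrightarrow> 0"
    proof -
      have "(\<lambda>n. r * inverse (real (Suc (Suc n)))) \<longlonglongrightarrow> r * 0"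
        by (intro tendsto_mult_left) (use LIMSEQ_Suc[OF LIMSEQ_inverse_real_of_nat] in simp)
      moreover have "cmod (h n) = r * inverse (real (Suc (Suc n)))" for n
        unfolding h_def norm_of_real using r by (simp add: divide_inverse abs_mult add.commute)
      ultimately show ?thesis by simp
    qed
    have "holomorphic_sev (pderiv_hol i f) (ball x r)"
    proof (rule holomorphic_sev_uniform_limit)
      show "holomorphic_sev (\<lambda>y. inverse (h n) * (f (y + axis i (h n)) - f y)) (ball x r)" for n
      proof (intro holomorphic_sev_cmult holomorphic_sev_diff)
        show "holomorphic_sev (\<lambda>y. f (y + axis i (h n))) (ball x r)"
        proof (rule holomorphic_sev_compose[OF f, where L = "\<lambda>v. v"])
          fix y assume y: "y \<in> ball x r"
          have "y + axis i (h n) \<in> cball y (2 * r)"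
            using h(2)[of n] r by (simp add: dist_norm)
          then show "y + axis i (h n) \<in> S" using sub[OF y] e by blast
        qed (auto intro!: derivative_eq_intros)
        show "holomorphic_sev f (ball x r)"
          by (rule holomorphic_sev_subset[OF f]) (use e in \<open>auto simp: r_def\<close>)
      qed
      show "uniform_limit (ball x r) (\<lambda>n y. inverse (h n) * (f (y + axis i (h n)) - f y))
          (pderiv_hol i f) sequentially"
      proof (rule uniform_limitI)
        fix d :: real assume d: "d > 0"
        have "(\<lambda>n. 2 * B / r\<^sup>2 * cmod (h n)) \<longlonglongrightarrow> 2 * B / r\<^sup>2 * 0"
          by (intro tendsto_mult_left h0)
        then have "\<forall>\<^sub>F n in sequentially. 2 * B / r\<^sup>2 * cmod (h n) < d"
          using d order_tendstoD(2)[of _ 0 sequentially d] by simp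
        then show "\<forall>\<^sub>F n in sequentially. \<forall>y\<in>ball x r.
            dist (inverse (h n) * (f (y + axis i (h n)) - f y)) (pderiv_hol i f y) < d"
        proof eventually_elim
          case (elim n)
          show ?case
          proof
            fix y assume y: "y \<in> ball x r"
            have "cmod ((f (y + axis i (h n)) - f y) / h n - pderiv_hol i f y) \<le> 2 * B / r\<^sup>2 * cmod (h n)"
              by (rule difference_quotient_bound[OF f r]) (use sub[OF y] e B h in auto)
            then show "dist (inverse (h n) * (f (y + axis i (h n)) - f y)) (pderiv_hol i f y) < d"
              using elim by (simp add: dist_norm divide_inverse mult.commute)
          qed
        qed
      qed
    qed simp
    then show ?thesis using r by (intro exI[of _ "ball x r"]) simp
  qed
  then show ?thesis unfolding holomorphic_sev_def by metis
qed

section \<open>Positive kernels and multipliers\<close>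

text \<open>The Schur product theorem with one factor a Gram matrix. Induction on the index set: subtracting
  from all vectors their component along one vector \<open>k x\<close> makes the row of \<open>x\<close> vanish and changes the
  Gram matrix by a matrix of rank one, whose product with \<open>A\<close> is non-negative definite.\<close>

lemma (in hilbert_space) Schur_product_Gram:
  assumes A: "nonneg_definite I A" and k: "\<And>i. i \<in> I \<Longrightarrow> k i \<in> V"
  shows "nonneg_definite I (\<lambda>i j. A i j * ip (k j) (k i))"
proof -
  have "(\<Sum>i\<in>F. \<Sum>j\<in>F. cnj (c i) * c j * (A i j * ip (k j) (k i))) \<in> \<real>\<^sub>\<ge>\<^sub>0"
    if "finite F" "F \<subseteq> I" "\<And>i. i \<in> F \<Longrightarrow> k i \<in> V" for F c k
    using that
  proof (induction F arbitrary: k rule: finite_induct)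
    case empty
    then show ?case by simp
  next
    case (insert x F)
    note fin = insert.hyps(1) and x = insert.hyps(2) and kV = insert.prems(2)
    \<comment> \<open>A zero vector contributes nothing to the sum.\<close>
    have drop: "(\<Sum>i\<in>insert x F. \<Sum>j\<in>insert x F. cnj (c i) * c j * (A i j * ip (k' j) (k' i))) \<in> \<real>\<^sub>\<ge>\<^sub>0"
      if k': "\<And>i. i \<in> insert x F \<Longrightarrow> k' i \<in> V" and 0: "k' x = 0" for k'
    proof -
      have "(\<Sum>i\<in>insert x F. \<Sum>j\<in>insert x F. cnj (c i) * c j * (A i j * ip (k' j) (k' i)))
          = (\<Sum>i\<in>F. \<Sum>j\<in>F. cnj (c i) * c j * (A i j * ip (k' j) (k' i)))"
        using fin x k' by (simp add: 0)
      also have "\<dots> \<in> \<real>\<^sub>\<ge>\<^sub>0"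
        using insert.IH[of k'] insert.prems(1) k' by simp
      finally show ?thesis .
    qed
    show ?case
    proof (cases "k x = 0")
      case True
      then show ?thesis using drop[of k] kV by blast
    next
      case False
      define n where "n = (hnorm ip (k x))\<^sup>2"
      have n: "n > 0" using False kV by (simp add: n_def)
      have nn: "ip (k x) (k x) = of_real n" using kV by (simp add: ip_self n_def)
      define k' where "k' i = k i - scale (ip (k i) (k x) / of_real n) (k x)" for i
      define d where "d j = c j * ip (k j) (k x)" for j
      have k': "k' i \<in> V" if "i \<in> insert x F" for i
        using kV[OF that] kV[of x] by (simp add: k'_def)
      have k'x: "k' x = 0" using n by (simp add: k'_def nn)
      have G: "ip (k j) (k i) = ip (k' j) (k' i) + ip (k j) (k x) * cnj (ip (k i) (k x)) / of_real n"
        if "i \<in> insert x F" "j \<in> insert x F" for i j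
      proof -
        have "ip (k x) (k i) = cnj (ip (k i) (k x))"
          using kV[OF that(1)] kV[of x] by (auto intro: ip_cnj)
        then show ?thesis
          using kV[OF that(1)] kV[OF that(2)] kV[of x] n
          by (simp add: k'_def ip_diff ip_diff_right ip_scale ip_scale_right nn)
      qed
      have "(\<Sum>i\<in>insert x F. \<Sum>j\<in>insert x F. cnj (c i) * c j * (A i j * ip (k j) (k i)))
          = (\<Sum>i\<in>insert x F. \<Sum>j\<in>insert x F. cnj (c i) * c j * (A i j * ip (k' j) (k' i))
              + cnj (d i) * d j * A i j / of_real n)"
      proof (intro sum.cong refl)
        fix i j assume ij: "i \<in> insert x F" "j \<in> insert x F"
        show "cnj (c i) * c j * (A i j * ip (k j) (k i))
          = cnj (c i) * c j * (A i j * ip (k' j) (k' i)) + cnj (d i) * d j * A i j / of_real n"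
          by (subst G[OF ij]) (simp add: d_def distrib_left mult_ac)
      qed
      also have "\<dots> = (\<Sum>i\<in>insert x F. \<Sum>j\<in>insert x F. cnj (c i) * c j * (A i j * ip (k' j) (k' i)))
          + (\<Sum>i\<in>insert x F. \<Sum>j\<in>insert x F. cnj (d i) * d j * A i j) / of_real n"
        unfolding sum.distrib sum_divide_distrib ..
      also have "\<dots> \<in> \<real>\<^sub>\<ge>\<^sub>0"
      proof (intro nonneg_Reals_add_I nonneg_Reals_divide_I drop k' k'x)
        show "(\<Sum>i\<in>insert x F. \<Sum>j\<in>insert x F. cnj (d i) * d j * A i j) \<in> \<real>\<^sub>\<ge>\<^sub>0"
          using A fin insert.prems(1) unfolding nonneg_definite_def by blast
        show "complex_of_real n \<in> \<real>\<^sub>\<ge>\<^sub>0" using n by simp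
      qed
      finally show ?thesis .
    qed
  qed
  then show ?thesis
    unfolding nonneg_definite_def using k by (meson subsetD)
qed

text \<open>The defect kernel of a multiplier \<open>\<phi>\<close> measures by how much \<open>k i \<mapsto> cnj (\<phi> i) k i\<close> falls short of
  the bound \<open>C\<close>.\<close>

lemma (in hilbert_space) multiplier_defect:
  assumes "\<And>i. i \<in> F \<Longrightarrow> k i \<in> V"
  shows "(\<Sum>i\<in>F. \<Sum>j\<in>F. cnj (c i) * c j * (((of_real C)\<^sup>2 - \<phi> i * cnj (\<phi> j)) * ip (k j) (k i)))
    = of_real (C\<^sup>2 * (hnorm ip (\<Sum>i\<in>F. scale (c i) (k i)))\<^sup>2
        - (hnorm ip (\<Sum>i\<in>F. scale (c i * cnj (\<phi> i)) (k i)))\<^sup>2)"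
proof -
  have "(\<Sum>i\<in>F. \<Sum>j\<in>F. cnj (c i) * c j * (((of_real C)\<^sup>2 - \<phi> i * cnj (\<phi> j)) * ip (k j) (k i)))
      = (of_real C)\<^sup>2 * (\<Sum>i\<in>F. \<Sum>j\<in>F. cnj (c i) * c j * ip (k j) (k i))
        - (\<Sum>i\<in>F. \<Sum>j\<in>F. cnj (c i * cnj (\<phi> i)) * (c j * cnj (\<phi> j)) * ip (k j) (k i))"
    unfolding sum_distrib_left sum_subtractf[symmetric]
    by (intro sum.cong refl) (simp add: algebra_simps)
  also have "\<dots> = of_real (C\<^sup>2 * (hnorm ip (\<Sum>i\<in>F. scale (c i) (k i)))\<^sup>2
        - (hnorm ip (\<Sum>i\<in>F. scale (c i * cnj (\<phi> i)) (k i)))\<^sup>2)"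
    using hnorm_combination_power2[OF assms, of F "\<lambda>i. i" c]
      hnorm_combination_power2[OF assms, of F "\<lambda>i. i" "\<lambda>i. c i * cnj (\<phi> i)"]
    by (simp del: complex_cnj_mult)
  finally show ?thesis .
qed

text \<open>A bounded operator of multiplication by \<open>\<phi>\<close> has the adjoint \<open>k i \<mapsto> cnj (\<phi> i) k i\<close> on the family
  of evaluation vectors; the defect kernel says that the adjoint is bounded by \<open>C\<close> on combinations.\<close>

lemma (in hilbert_space) multiplier_imp_nonneg_definite:
  assumes k: "\<And>i. i \<in> I \<Longrightarrow> k i \<in> V"
    and M: "\<And>f. f \<in> V \<Longrightarrow> M f \<in> V" "\<And>f. f \<in> V \<Longrightarrow> hnorm ip (M f) \<le> C * hnorm ip f"
      "\<And>f i. f \<in> V \<Longrightarrow> i \<in> I \<Longrightarrow> ip (M f) (k i) = \<phi> i * ip f (k i)"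
  shows "nonneg_definite I (\<lambda>i j. ((of_real C)\<^sup>2 - \<phi> i * cnj (\<phi> j)) * ip (k j) (k i))"
  unfolding nonneg_definite_def
proof (intro allI impI)
  fix F c assume F: "finite F \<and> F \<subseteq> I"
  then have kF: "k i \<in> V" if "i \<in> F" for i using k that by blast
  define u where "u = (\<Sum>i\<in>F. scale (c i) (k i))"
  define u' where "u' = (\<Sum>i\<in>F. scale (c i * cnj (\<phi> i)) (k i))"
  have uV: "u \<in> V" "u' \<in> V" by (auto simp: u_def u'_def kF intro!: V_sum)
  have "ip u' u' = (\<Sum>i\<in>F. cnj (c i) * (\<phi> i * ip u' (k i)))"
    by (subst (2) u'_def) (simp add: ip_sum_right ip_scale_right uV kF mult.assoc)
  also have "\<dots> = (\<Sum>i\<in>F. cnj (c i) * ip (M u') (k i))"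
    using F uV M(3) by (intro sum.cong) auto
  also have "\<dots> = ip (M u') u"
    by (simp add: u_def ip_sum_right ip_scale_right M uV kF)
  finally have "(hnorm ip u')\<^sup>2 \<le> cmod (ip (M u') u)"
    using complex_Re_le_cmod[of "ip (M u') u"] uV by (simp add: hnorm_power2)
  also have "\<dots> \<le> hnorm ip (M u') * hnorm ip u"
    by (intro Cauchy_Schwarz M uV)
  also have "\<dots> \<le> (C * hnorm ip u') * hnorm ip u"
    by (intro mult_right_mono M uV hnorm_nonneg)
  finally have le: "hnorm ip u' * hnorm ip u' \<le> (C * hnorm ip u) * hnorm ip u'"
    by (simp add: power2_eq_square mult_ac)
  have "(hnorm ip u')\<^sup>2 \<le> C\<^sup>2 * (hnorm ip u)\<^sup>2"
  proof (cases "hnorm ip u' = 0")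
    case False
    then have "hnorm ip u' > 0" using hnorm_nonneg[OF uV(2)] by linarith
    with le have "hnorm ip u' \<le> C * hnorm ip u" by simp
    then have "(hnorm ip u')\<^sup>2 \<le> (C * hnorm ip u)\<^sup>2"
      using uV by (intro power_mono) auto
    then show ?thesis by (simp add: power_mult_distrib)
  qed simp
  moreover have "(\<Sum>z\<in>F. \<Sum>w\<in>F. cnj (c z) * c w * (((of_real C)\<^sup>2 - \<phi> z * cnj (\<phi> w)) * ip (k w) (k z)))
      = of_real (C\<^sup>2 * (hnorm ip u)\<^sup>2 - (hnorm ip u')\<^sup>2)"
    unfolding u_def u'_def by (rule multiplier_defect) (rule kF)
  ultimately show "(\<Sum>z\<in>F. \<Sum>w\<in>F. cnj (c z) * c w * (((of_real C)\<^sup>2 - \<phi> z * cnj (\<phi> w)) * ip (k w) (k z))) \<in> \<real>\<^sub>\<ge>\<^sub>0"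
    by (simp only: nonneg_Reals_of_real_iff diff_ge_0_iff_ge)
qed

text \<open>Conversely, the bound on combinations makes the moments \<open>\<phi> i * ip f (k i)\<close> those of a vector,
  which is the product of \<open>\<phi>\<close> and \<open>f\<close> when the \<open>k i\<close> are kernel functions.\<close>

lemma (in hilbert_space) nonneg_definite_imp_multiplier:
  assumes k: "\<And>i. i \<in> I \<Longrightarrow> k i \<in> V"
    and psd: "nonneg_definite I (\<lambda>i j. ((of_real C)\<^sup>2 - \<phi> i * cnj (\<phi> j)) * ip (k j) (k i))"
    and C: "C \<ge> 0" and f: "f \<in> V"
  obtains g where "g \<in> V" "hnorm ip g \<le> C * hnorm ip f" "\<And>i. i \<in> I \<Longrightarrow> ip g (k i) = \<phi> i * ip f (k i)"
proof (rule moment_problem[of I k "\<lambda>i. \<phi> i * ip f (k i)" "C * hnorm ip f"])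
  fix F c assume F: "finite F" "F \<subseteq> I"
  then have kF: "k i \<in> V" if "i \<in> F" for i using k that by blast
  define u where "u = (\<Sum>i\<in>F. scale (c i) (k i))"
  define u' where "u' = (\<Sum>i\<in>F. scale (c i * cnj (\<phi> i)) (k i))"
  have uV: "u \<in> V" "u' \<in> V" by (auto simp: u_def u'_def kF intro!: V_sum)
  have "(\<Sum>z\<in>F. \<Sum>w\<in>F. cnj (c z) * c w * (((of_real C)\<^sup>2 - \<phi> z * cnj (\<phi> w)) * ip (k w) (k z))) \<in> \<real>\<^sub>\<ge>\<^sub>0"
    using psd F unfolding nonneg_definite_def by blast
  moreover have "(\<Sum>z\<in>F. \<Sum>w\<in>F. cnj (c z) * c w * (((of_real C)\<^sup>2 - \<phi> z * cnj (\<phi> w)) * ip (k w) (k z)))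
      = of_real (C\<^sup>2 * (hnorm ip u)\<^sup>2 - (hnorm ip u')\<^sup>2)"
    unfolding u_def u'_def by (rule multiplier_defect) (rule kF)
  ultimately have "(hnorm ip u')\<^sup>2 \<le> C\<^sup>2 * (hnorm ip u)\<^sup>2"
    by (simp only: nonneg_Reals_of_real_iff diff_ge_0_iff_ge)
  then have "(hnorm ip u')\<^sup>2 \<le> (C * hnorm ip u)\<^sup>2" by (simp add: power_mult_distrib)
  then have le: "hnorm ip u' \<le> C * hnorm ip u"
    by (rule power2_le_imp_le) (simp add: C uV)
  have "(\<Sum>i\<in>F. c i * cnj (\<phi> i * ip f (k i))) = ip u' f"
    using ip_cnj[OF f kF] by (simp add: u'_def ip_sum kF f ip_scale mult.assoc)
  also have "cmod \<dots> \<le> hnorm ip u' * hnorm ip f"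
    by (intro Cauchy_Schwarz uV f)
  also have "\<dots> \<le> (C * hnorm ip u) * hnorm ip f"
    by (intro mult_right_mono le hnorm_nonneg f)
  finally show "cmod (\<Sum>i\<in>F. c i * cnj (\<phi> i * ip f (k i))) \<le> C * hnorm ip f * hnorm ip (\<Sum>i\<in>F. scale (c i) (k i))"
    by (simp add: u_def mult_ac)
qed (use k C f that in auto)

subsection \<open>Reproducing kernels\<close>

abbreviation kernel_at :: "(complex^'n) set \<Rightarrow> (complex^'n \<Rightarrow> complex^'n \<Rightarrow> complex) \<Rightarrow>
  complex^'n \<Rightarrow> complex^'n \<Rightarrow> complex" where
  "kernel_at S L w \<equiv> restr S (\<lambda>z. L z w)"

lemma is_rkhsD:
  assumes "is_rkhs S L V ip"
  shows "hilbert_space fscale V ip"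
    "f \<in> V \<Longrightarrow> holomorphic_sev f S" "f \<in> V \<Longrightarrow> z \<notin> S \<Longrightarrow> f z = 0"
    "w \<in> S \<Longrightarrow> kernel_at S L w \<in> V" "w \<in> S \<Longrightarrow> f \<in> V \<Longrightarrow> ip f (kernel_at S L w) = f w"
  using assms unfolding is_rkhs_def by auto

lemma is_rkhs_gram:
  assumes "is_rkhs S L V ip" "z \<in> S" "w \<in> S"
  shows "ip (kernel_at S L w) (kernel_at S L z) = L z w"
  using is_rkhsD(5)[OF assms(1,2) is_rkhsD(4)[OF assms(1,3)]] assms(2) by (simp add: restr_def)

lemma is_rkhs_hermitian:
  assumes "is_rkhs S L V ip" "z \<in> S" "w \<in> S"
  shows "cnj (L z w) = L w z"
proof -
  interpret hilbert_space fscale V ip using assms(1) by (rule is_rkhsD)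
  show ?thesis
    using ip_cnj[of "kernel_at S L w" "kernel_at S L z"] is_rkhsD(4)[OF assms(1)] assms
    by (simp add: is_rkhs_gram)
qed

lemma pderiv_hol_add:
  assumes "holomorphic_sev f S" "holomorphic_sev g S" "x \<in> S"
  shows "pderiv_hol i (f + g) x = pderiv_hol i f x + pderiv_hol i g x"
  using DERIV_imp_deriv[OF DERIV_add[OF holomorphic_sev_pderiv_at[OF assms(1,3), of i]
      holomorphic_sev_pderiv_at[OF assms(2,3), of i]]]
  by (simp add: pderiv_hol_def)

lemma pderiv_hol_fscale:
  assumes "holomorphic_sev f S" "x \<in> S"
  shows "pderiv_hol i (fscale c f) x = c * pderiv_hol i f x"
  using DERIV_imp_deriv[OF DERIV_cmult[OF holomorphic_sev_pderiv_at[OF assms, of i], of c]]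
  by (simp add: pderiv_hol_def fscale_def)

text \<open>Derivatives at a point are bounded functionals, by the Cauchy estimate and the local boundedness
  of the point evaluations; their representing vectors are the antiholomorphic derivatives of the
  kernel.\<close>

lemma is_rkhs_pderiv_representer:
  assumes rk: "is_rkhs S L V ip" and S: "open S" and x: "x \<in> S"
    and cont: "continuous_on S (\<lambda>z. L z z)"
  obtains d where "d \<in> V" "\<And>f. f \<in> V \<Longrightarrow> ip f d = pderiv_hol i f x"
    "\<And>y. y \<in> S \<Longrightarrow> d y = cnj (pderiv_hol i (\<lambda>z. L z y) x)"
proof -
  interpret hilbert_space fscale V ip using rk by (rule is_rkhsD)
  obtain r where r: "r > 0" "cball x r \<subseteq> S"
    using S x open_contains_cball by blast
  have "bounded ((\<lambda>z. L z z) ` cball x r)"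
    by (intro compact_imp_bounded compact_continuous_image continuous_on_subset[OF cont r(2)]) simp
  then obtain B where B: "\<And>z. z \<in> cball x r \<Longrightarrow> cmod (L z z) \<le> B"
    unfolding bounded_iff by blast
  have B0: "B \<ge> 0" using order_trans[OF norm_ge_zero B[of x]] r by simp
  have eval: "cmod (f z) \<le> sqrt B * hnorm ip f" if f: "f \<in> V" and z: "z \<in> cball x r" for f z
  proof -
    have zS: "z \<in> S" using z r by blast
    have kV: "kernel_at S L z \<in> V" using rk zS by (rule is_rkhsD)
    have "(hnorm ip (kernel_at S L z))\<^sup>2 = Re (L z z)"
      by (simp add: hnorm_power2 kV is_rkhs_gram[OF rk zS zS])
    also have "\<dots> \<le> B" using complex_Re_le_cmod[of "L z z"] B[OF z] by simp
    finally have "hnorm ip (kernel_at S L z) \<le> sqrt B" by (rule real_le_rsqrt)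
    then have "hnorm ip f * hnorm ip (kernel_at S L z) \<le> hnorm ip f * sqrt B"
      by (intro mult_left_mono hnorm_nonneg f)
    then show ?thesis
      using Cauchy_Schwarz[OF f kV] is_rkhsD(5)[OF rk zS f] by (simp add: mult.commute)
  qed
  have bd: "cmod (pderiv_hol i f x) \<le> (sqrt B / r) * hnorm ip f" if f: "f \<in> V" for f
    using Cauchy_estimate_frechet[OF is_rkhsD(2)[OF rk f] r eval[OF f], of "axis i 1"]
    by (simp add: pderiv_hol_frechet[OF is_rkhsD(2)[OF rk f] x])
  obtain d where d: "d \<in> V" "\<And>f. f \<in> V \<Longrightarrow> ip f d = pderiv_hol i f x"
    by (rule riesz_representation[of "\<lambda>f. pderiv_hol i f x" "sqrt B / r"])
      (use bd B0 r(1) in \<open>auto simp: pderiv_hol_add[OF is_rkhsD(2)[OF rk] is_rkhsD(2)[OF rk] x]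
        pderiv_hol_fscale[OF is_rkhsD(2)[OF rk] x]\<close>)
  have "d y = cnj (pderiv_hol i (\<lambda>z. L z y) x)" if y: "y \<in> S" for y
  proof -
    have kV: "kernel_at S L y \<in> V" using rk y by (rule is_rkhsD)
    have "d y = cnj (ip (kernel_at S L y) d)"
      using ip_cnj[OF kV d(1)] is_rkhsD(5)[OF rk y d(1)] by simp
    also have "ip (kernel_at S L y) d = pderiv_hol i (\<lambda>z. L z y) x"
      using d(2)[OF kV] pderiv_hol_cong[OF S x, of "kernel_at S L y" "\<lambda>z. L z y" i]
      by (simp add: restr_def)
    finally show ?thesis .
  qed
  with d show thesis using that by blast
qed

subsection \<open>Multipliers of reproducing kernel spaces\<close>

definition bounded_multiplier :: "('x \<Rightarrow> complex) set \<Rightarrow>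
  (('x \<Rightarrow> complex) \<Rightarrow> ('x \<Rightarrow> complex) \<Rightarrow> complex) \<Rightarrow> ('x \<Rightarrow> complex) \<Rightarrow> bool" where
  "bounded_multiplier V ip \<phi> \<longleftrightarrow>
    (\<exists>C\<ge>0. \<forall>f\<in>V. (\<lambda>x. \<phi> x * f x) \<in> V \<and> hnorm ip (\<lambda>x. \<phi> x * f x) \<le> C * hnorm ip f)"

context
  fixes V and ip :: "('x \<Rightarrow> complex) \<Rightarrow> ('x \<Rightarrow> complex) \<Rightarrow> complex"
  assumes hilb: "hilbert_space fscale V ip"
begin

interpretation hilbert_space fscale V ip by (rule hilb)

lemma bounded_multiplier_const: "bounded_multiplier V ip (\<lambda>_. c)"
  unfolding bounded_multiplier_def
  using V_scale[of _ c] hnorm_scale[of _ c] by (intro exI[of _ "cmod c"]) (simp add: fscale_def)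

lemma bounded_multiplier_add:
  assumes "bounded_multiplier V ip \<phi>" "bounded_multiplier V ip \<psi>"
  shows "bounded_multiplier V ip (\<lambda>x. \<phi> x + \<psi> x)"
proof -
  obtain C where C: "C \<ge> 0" "\<And>f. f \<in> V \<Longrightarrow> (\<lambda>x. \<phi> x * f x) \<in> V"
    "\<And>f. f \<in> V \<Longrightarrow> hnorm ip (\<lambda>x. \<phi> x * f x) \<le> C * hnorm ip f"
    using assms(1) unfolding bounded_multiplier_def by blast
  obtain D where D: "D \<ge> 0" "\<And>f. f \<in> V \<Longrightarrow> (\<lambda>x. \<psi> x * f x) \<in> V"
    "\<And>f. f \<in> V \<Longrightarrow> hnorm ip (\<lambda>x. \<psi> x * f x) \<le> D * hnorm ip f"
    using assms(2) unfolding bounded_multiplier_def by blast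
  have eq: "(\<lambda>x. (\<phi> x + \<psi> x) * f x) = (\<lambda>x. \<phi> x * f x) + (\<lambda>x. \<psi> x * f x)" for f
    by (auto simp: fun_eq_iff distrib_right)
  show ?thesis
    unfolding bounded_multiplier_def
  proof (intro exI[of _ "C + D"] conjI ballI)
    fix f assume f: "f \<in> V"
    show "(\<lambda>x. (\<phi> x + \<psi> x) * f x) \<in> V"
      unfolding eq using C D f by simp
    show "hnorm ip (\<lambda>x. (\<phi> x + \<psi> x) * f x) \<le> (C + D) * hnorm ip f"
      unfolding eq using hnorm_triangle[OF C(2)[OF f] D(2)[OF f]] C(3)[OF f] D(3)[OF f]
      by (simp add: distrib_right)
  qed (use C D in simp)
qed

lemma bounded_multiplier_mult:
  assumes "bounded_multiplier V ip \<phi>" "bounded_multiplier V ip \<psi>"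
  shows "bounded_multiplier V ip (\<lambda>x. \<phi> x * \<psi> x)"
proof -
  obtain C where C: "C \<ge> 0" "\<And>f. f \<in> V \<Longrightarrow> (\<lambda>x. \<phi> x * f x) \<in> V"
    "\<And>f. f \<in> V \<Longrightarrow> hnorm ip (\<lambda>x. \<phi> x * f x) \<le> C * hnorm ip f"
    using assms(1) unfolding bounded_multiplier_def by blast
  obtain D where D: "D \<ge> 0" "\<And>f. f \<in> V \<Longrightarrow> (\<lambda>x. \<psi> x * f x) \<in> V"
    "\<And>f. f \<in> V \<Longrightarrow> hnorm ip (\<lambda>x. \<psi> x * f x) \<le> D * hnorm ip f"
    using assms(2) unfolding bounded_multiplier_def by blast
  show ?thesis
    unfolding bounded_multiplier_def
  proof (intro exI[of _ "C * D"] conjI ballI)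
    fix f assume f: "f \<in> V"
    show "(\<lambda>x. \<phi> x * \<psi> x * f x) \<in> V"
      using C(2)[OF D(2)[OF f]] by (simp add: mult.assoc)
    have "hnorm ip (\<lambda>x. \<phi> x * \<psi> x * f x) \<le> C * hnorm ip (\<lambda>x. \<psi> x * f x)"
      using C(3)[OF D(2)[OF f]] by (simp add: mult.assoc)
    also have "\<dots> \<le> C * (D * hnorm ip f)"
      by (intro mult_left_mono D f C)
    finally show "hnorm ip (\<lambda>x. \<phi> x * \<psi> x * f x) \<le> C * D * hnorm ip f"
      by (simp add: mult.assoc)
  qed (use C D in simp)
qed

lemma bounded_multiplier_sum:
  "(\<And>i. i \<in> F \<Longrightarrow> bounded_multiplier V ip (\<phi> i)) \<Longrightarrow> bounded_multiplier V ip (\<lambda>x. \<Sum>i\<in>F. \<phi> i x)"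
  by (induction F rule: infinite_finite_induct)
    (auto intro: bounded_multiplier_const bounded_multiplier_add)

lemma bounded_multiplier_prod:
  "(\<And>i. i \<in> F \<Longrightarrow> bounded_multiplier V ip (\<phi> i)) \<Longrightarrow> bounded_multiplier V ip (\<lambda>x. \<Prod>i\<in>F. \<phi> i x)"
  by (induction F rule: infinite_finite_induct)
    (auto intro: bounded_multiplier_const bounded_multiplier_mult)

lemma bounded_multiplier_power:
  "bounded_multiplier V ip \<phi> \<Longrightarrow> bounded_multiplier V ip (\<lambda>x. \<phi> x ^ n)"
  by (induction n) (auto intro: bounded_multiplier_const bounded_multiplier_mult)

end

lemma bounded_multiplier_cpoly_eval:
  assumes "hilbert_space fscale V ip" "\<And>i. bounded_multiplier V ip (\<lambda>x. x $ i)"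
  shows "bounded_multiplier V ip (cpoly_eval p)"
  unfolding cpoly_eval_def[abs_def]
  by (intro bounded_multiplier_sum bounded_multiplier_mult bounded_multiplier_prod
    bounded_multiplier_power bounded_multiplier_const assms)

text \<open>A multiplier of the space of one factor acts boundedly on the space of a product kernel:
  multiplied by the other kernel, its defect kernel stays non-negative definite.\<close>

lemma product_kernel_multiplier:
  assumes H: "is_rkhs \<Omega> L H ipH" and H': "is_rkhs \<Omega>' L' H' ipH'" and T: "is_rkhs S M T ipT"
    and p: "\<And>x. x \<in> S \<Longrightarrow> p x \<in> \<Omega>" and q: "\<And>x. x \<in> S \<Longrightarrow> q x \<in> \<Omega>'"
    and M: "\<And>x y. x \<in> S \<Longrightarrow> y \<in> S \<Longrightarrow> M x y = L (p x) (p y) * L' (q x) (q y)"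
    and mult: "bounded_operator fscale H ipH (\<lambda>f z. \<phi> z * f z)"
  shows "bounded_multiplier T ipT (\<lambda>x. \<phi> (p x))"
proof -
  interpret H: hilbert_space fscale H ipH using H by (rule is_rkhsD)
  interpret H': hilbert_space fscale H' ipH' using H' by (rule is_rkhsD)
  interpret T: hilbert_space fscale T ipT using T by (rule is_rkhsD)
  obtain C0 where C0: "\<And>f. f \<in> H \<Longrightarrow> hnorm ipH (\<lambda>z. \<phi> z * f z) \<le> C0 * hnorm ipH f"
    and HM: "\<And>f. f \<in> H \<Longrightarrow> (\<lambda>z. \<phi> z * f z) \<in> H"
    using mult unfolding bounded_operator_def linear_betw_def by blast
  define C where "C = \<bar>C0\<bar>"
  have C: "hnorm ipH (\<lambda>z. \<phi> z * f z) \<le> C * hnorm ipH f" if "f \<in> H" for f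
  proof -
    have "C0 * hnorm ipH f \<le> C * hnorm ipH f"
      using that by (intro mult_right_mono) (auto simp: C_def)
    then show ?thesis using C0[OF that] by simp
  qed
  let ?k = "\<lambda>x. kernel_at \<Omega> L (p x)" and ?k' = "\<lambda>x. kernel_at \<Omega>' L' (q x)"
  have "nonneg_definite S (\<lambda>x y. ((of_real C)\<^sup>2 - \<phi> (p x) * cnj (\<phi> (p y))) * ipH (?k y) (?k x))"
    by (rule H.multiplier_imp_nonneg_definite[where M = "\<lambda>f z. \<phi> z * f z"])
      (auto simp: HM C is_rkhsD(4,5)[OF H] p)
  then have "nonneg_definite S (\<lambda>x y. ((of_real C)\<^sup>2 - \<phi> (p x) * cnj (\<phi> (p y))) * ipH (?k y) (?k x)
      * ipH' (?k' y) (?k' x))"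
    by (rule H'.Schur_product_Gram) (auto simp: is_rkhsD(4)[OF H'] q)
  moreover have "((of_real C)\<^sup>2 - \<phi> (p x) * cnj (\<phi> (p y))) * ipH (?k y) (?k x) * ipH' (?k' y) (?k' x)
      = ((of_real C)\<^sup>2 - \<phi> (p x) * cnj (\<phi> (p y))) * ipT (kernel_at S M y) (kernel_at S M x)"
    if "x \<in> S" "y \<in> S" for x y
    using that by (simp add: is_rkhs_gram[OF H] is_rkhs_gram[OF H'] is_rkhs_gram[OF T] p q M)
  ultimately have psd: "nonneg_definite S (\<lambda>x y. ((of_real C)\<^sup>2 - \<phi> (p x) * cnj (\<phi> (p y)))
      * ipT (kernel_at S M y) (kernel_at S M x))"
    unfolding nonneg_definite_def by (simp add: subset_eq cong: sum.cong)
  show ?thesis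
    unfolding bounded_multiplier_def
  proof (intro exI[of _ C] conjI ballI)
    fix f assume f: "f \<in> T"
    obtain g where g: "g \<in> T" "hnorm ipT g \<le> C * hnorm ipT f"
      "\<And>x. x \<in> S \<Longrightarrow> ipT g (kernel_at S M x) = \<phi> (p x) * ipT f (kernel_at S M x)"
      by (rule T.nonneg_definite_imp_multiplier[OF _ psd _ f]) (auto simp: is_rkhsD(4)[OF T] C_def)
    have "g = (\<lambda>x. \<phi> (p x) * f x)"
    proof
      fix x show "g x = \<phi> (p x) * f x"
        using g(3)[of x] g(1) f is_rkhsD(3)[OF T f, of x] is_rkhsD(3)[OF T g(1), of x]
        by (cases "x \<in> S") (simp_all add: is_rkhsD(5)[OF T])
    qed
    with g show "(\<lambda>x. \<phi> (p x) * f x) \<in> T" "hnorm ipT (\<lambda>x. \<phi> (p x) * f x) \<le> C * hnorm ipT f"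
      by auto
  qed (simp add: C_def)
qed

subsection \<open>Evaluation of polynomials\<close>

lemma cpoly_eval_superset:
  assumes "finite F" "Poly_Mapping.keys p \<subseteq> F"
  shows "cpoly_eval p x =
    (\<Sum>\<mu>\<in>F. Poly_Mapping.lookup p \<mu> * (\<Prod>i\<in>UNIV. x $ i ^ Poly_Mapping.lookup \<mu> i))"
  unfolding cpoly_eval_def using assms
  by (intro sum.mono_neutral_left) (auto simp: in_keys_iff)

lemma cpoly_eval_add: "cpoly_eval (p + q) x = cpoly_eval p x + cpoly_eval q x"
proof -
  have sub: "Poly_Mapping.keys p \<union> Poly_Mapping.keys q \<supseteq> Poly_Mapping.keys (p + q)"
    by (rule Poly_Mapping.keys_add)
  show ?thesis
    using cpoly_eval_superset[OF _ sub, of x]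
      cpoly_eval_superset[of "Poly_Mapping.keys p \<union> Poly_Mapping.keys q" p x]
      cpoly_eval_superset[of "Poly_Mapping.keys p \<union> Poly_Mapping.keys q" q x]
    by (simp add: lookup_add distrib_right sum.distrib)
qed

lemma cpoly_eval_zero: "cpoly_eval 0 x = 0"
  by (simp add: cpoly_eval_def)

lemma cpoly_eval_sum: "cpoly_eval (\<Sum>i\<in>F. p i) x = (\<Sum>i\<in>F. cpoly_eval (p i) x)"
  by (induction F rule: infinite_finite_induct) (auto simp: cpoly_eval_add cpoly_eval_zero)

lemma cpoly_eval_single:
  "cpoly_eval (Poly_Mapping.single \<mu> a) x = a * (\<Prod>i\<in>UNIV. x $ i ^ Poly_Mapping.lookup \<mu> i)"
  by (subst cpoly_eval_superset[of "{\<mu>}"]) auto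

lemma cpoly_eval_one: "cpoly_eval 1 x = 1"
  by (simp add: cpoly_eval_single flip: single_one)

lemma cpoly_sum_singles:
  "p = (\<Sum>\<mu>\<in>Poly_Mapping.keys p. Poly_Mapping.single \<mu> (Poly_Mapping.lookup p \<mu>))"
  by (rule poly_mapping_eqI)
    (simp add: lookup_sum lookup_single when_def sum.delta in_keys_iff)

lemma cpoly_eval_mult: "cpoly_eval (p * q) x = cpoly_eval p x * cpoly_eval q x"
proof -
  have "cpoly_eval (p * q) x = cpoly_eval
      ((\<Sum>\<mu>\<in>Poly_Mapping.keys p. Poly_Mapping.single \<mu> (Poly_Mapping.lookup p \<mu>)) *
       (\<Sum>\<nu>\<in>Poly_Mapping.keys q. Poly_Mapping.single \<nu> (Poly_Mapping.lookup q \<nu>))) x"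
    by (simp flip: cpoly_sum_singles)
  also have "\<dots> = cpoly_eval p x * cpoly_eval q x"
    by (simp add: sum_product mult_single cpoly_eval_sum cpoly_eval_single lookup_add power_add
        prod.distrib cpoly_eval_def[of p] cpoly_eval_def[of q] mult_ac)
  finally show ?thesis .
qed

lemma cpoly_eval_axis_holomorphic: "(\<lambda>t. cpoly_eval p (x + axis i t)) holomorphic_on A"
proof -
  have "(\<lambda>t. (x + axis i t) $ j) holomorphic_on A" for j
    by (cases "i = j") (auto simp: axis_def intro!: holomorphic_intros)
  then show ?thesis
    unfolding cpoly_eval_def by (intro holomorphic_intros) auto
qed

section \<open>Logarithmic derivatives\<close>

lemma DERIV_eventually_eq:
  "(f has_field_derivative d) (at a) \<Longrightarrow> \<forall>\<^sub>F x in nhds a. f x = g x \<Longrightarrow> (g has_field_derivative d) (at a)"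
  using DERIV_cong_ev[of a a f g d d] by simp

text \<open>Only continuity of the branch of the logarithm is given; its differentiability is inherited from
  its exponential.\<close>

lemma DERIV_continuous_log:
  assumes cont: "isCont g a" and der: "((\<lambda>t. exp (g t)) has_field_derivative E) (at a)"
  shows "(g has_field_derivative E / exp (g a)) (at (a::complex))"
proof -
  \<comment> \<open>Near \<open>a\<close> the continuous branch \<open>g - g a\<close> is the principal logarithm of \<open>exp g / exp (g a)\<close>.\<close>
  have "((\<lambda>t. exp (g t) / exp (g a)) has_field_derivative E / exp (g a)) (at a)"
    using der by (rule DERIV_cdivide)
  moreover have "(Ln has_field_derivative 1) (at (exp (g a) / exp (g a)))"
    using has_field_derivative_Ln[of 1] by simp
  ultimately have "((\<lambda>t. Ln (exp (g t) / exp (g a))) has_field_derivative 1 * (E / exp (g a))) (at a)"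
    by (rule DERIV_chain2[rotated])
  then have "((\<lambda>t. g a + Ln (exp (g t) / exp (g a))) has_field_derivative E / exp (g a)) (at a)"
    using DERIV_add[OF DERIV_const[of "g a" "at a"]] by fastforce
  moreover have "\<forall>\<^sub>F t in nhds a. dist (g t) (g a) < pi"
    using cont by (intro tendstoD) (auto simp: isCont_def tendsto_at_iff_tendsto_nhds)
  then have "\<forall>\<^sub>F t in nhds a. g a + Ln (exp (g t) / exp (g a)) = g t"
  proof eventually_elim
    case (elim t)
    have "\<bar>Im (g t - g a)\<bar> < pi"
      using elim abs_Im_le_cmod[of "g t - g a"] by (simp add: dist_norm)
    then have "Ln (exp (g t - g a)) = g t - g a" by (intro Ln_exp) auto
    then show ?case by (simp add: exp_diff)
  qed
  ultimately show ?thesis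
    by (rule DERIV_eventually_eq)
qed

section \<open>The product domain and its diagonal\<close>

lemma vfst_diag [simp]: "vfst (diag z) = z" and vsnd_diag [simp]: "vsnd (diag z) = z"
  by (simp_all add: vfst_def vsnd_def diag_def vec_eq_iff)

lemma diag_in_sq_dom [simp]: "diag z \<in> sq_dom \<Omega> \<longleftrightarrow> z \<in> \<Omega>"
  by (simp add: sq_dom_def)

lemma vfst_axis [simp]:
  "vfst (x + axis (Inl j) t) = vfst x + axis j t" "vfst (x + axis (Inr j) t) = vfst x"
  and vsnd_axis [simp]:
  "vsnd (x + axis (Inr j) t) = vsnd x + axis j t" "vsnd (x + axis (Inl j) t) = vsnd x"
  by (simp_all add: vfst_def vsnd_def vec_eq_iff axis_def)

lemma diag_axis: "diag (z + t *s axis j 1) = diag z + t *s (axis (Inl j) 1 + axis (Inr j) 1)"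
  by (auto simp: diag_def vec_eq_iff axis_def split: sum.split)

lemma open_sq_dom:
  assumes "open \<Omega>"
  shows "open (sq_dom \<Omega>)"
proof -
  have "continuous_on UNIV vfst" "continuous_on UNIV vsnd"
    unfolding vfst_def[abs_def] vsnd_def[abs_def] by (intro continuous_intros)+
  then have "open (vfst -` \<Omega>)" "open (vsnd -` \<Omega>)"
    using assms by (auto intro: open_vimage)
  moreover have "sq_dom \<Omega> = vfst -` \<Omega> \<inter> vsnd -` \<Omega>" by (auto simp: sq_dom_def)
  ultimately show ?thesis by (simp add: open_Int)
qed

lemma diag_has_derivative: "(diag has_derivative diag) (at (z :: complex^'m))"
proof -
  have "linear (diag :: complex^'m \<Rightarrow> _)"
    by (rule linearI) (auto simp: diag_def vec_eq_iff split: sum.split)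
  then show ?thesis
    by (intro bounded_linear_imp_has_derivative) (simp add: linear_conv_bounded_linear)
qed

lemma holomorphic_sev_diag:
  assumes "holomorphic_sev f (sq_dom \<Omega>)"
  shows "holomorphic_sev (\<lambda>z. f (diag z)) \<Omega>"
proof (rule holomorphic_sev_compose[OF assms, where L = diag])
  show "diag (c *s v) = c *s diag v" for c :: complex and v :: "complex^'a"
    by (auto simp: diag_def vec_eq_iff split: sum.split)
qed (auto intro: diag_has_derivative)

text \<open>The direction \<open>Inl j + Inr j\<close> is tangent to the diagonal.\<close>

lemma pderiv_hol_vanishing_on_diag:
  assumes f: "holomorphic_sev f (sq_dom \<Omega>)" and \<Omega>: "open \<Omega>" and z: "z \<in> \<Omega>"
    and 0: "\<And>u. u \<in> \<Omega> \<Longrightarrow> f (diag u) = 0"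
  shows "pderiv_hol (Inl j) f (diag z) = - pderiv_hol (Inr j) f (diag z)"
proof -
  let ?D = "frechet_derivative f (at (diag z))"
  have dz: "diag z \<in> sq_dom \<Omega>" using z by simp
  interpret D: bounded_linear ?D
    using holomorphic_sev_frechet(1)[OF f dz] by (rule has_derivative_bounded_linear)
  have "pderiv_hol j (\<lambda>u. f (diag u)) z = pderiv_hol j (\<lambda>_. 0) z"
    by (rule pderiv_hol_cong[OF \<Omega> z]) (rule 0)
  then have d0: "deriv (\<lambda>t. f (diag (z + t *s axis j 1))) 0 = 0"
    by (simp add: pderiv_hol_def flip: axis_smult)
  have "((\<lambda>t. f (diag (z + t *s axis j 1))) has_field_derivative
      ?D (axis (Inl j) 1 + axis (Inr j) 1)) (at 0)"
    using holomorphic_sev_line[OF f, of "diag z" 0 "axis (Inl j) 1 + axis (Inr j) 1"] dz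
    by (simp add: diag_axis)
  from DERIV_imp_deriv[OF this] have "?D (axis (Inl j) 1 + axis (Inr j) 1) = 0"
    by (simp only: d0)
  then show ?thesis
    by (simp add: D.add pderiv_hol_frechet[OF f dz] add_eq_0_iff)
qed

text \<open>At a zero of \<open>f\<close> only one term of the product rule survives. This makes both submodules invariant
  and the map compatible with the module actions.\<close>

lemma pderiv_hol_cpoly_mult:
  assumes f: "holomorphic_sev f S" and x: "x \<in> S" and 0: "f x = 0"
  shows "pderiv_hol i (\<lambda>x. cpoly_eval p x * f x) x = cpoly_eval p x * pderiv_hol i f x"
proof -
  have "((\<lambda>t. cpoly_eval p (x + axis i t)) has_field_derivative deriv (\<lambda>t. cpoly_eval p (x + axis i t)) 0) (at 0)"
    by (rule holomorphic_derivI[OF cpoly_eval_axis_holomorphic[of p x i UNIV]]) auto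
  from DERIV_mult[OF this holomorphic_sev_pderiv_at[OF f x, of i]]
  have "((\<lambda>t. cpoly_eval p (x + axis i t) * f (x + axis i t)) has_field_derivative
      cpoly_eval p x * pderiv_hol i f x) (at 0)"
    by (simp add: 0 mult.commute)
  then show ?thesis
    unfolding pderiv_hol_def[of _ "\<lambda>x. cpoly_eval p x * f x"] by (rule DERIV_imp_deriv)
qed

section \<open>The submodule and the curvature kernel\<close>

locale kernel_power_pair =
  fixes \<Omega> :: "(complex^'m) set" and l :: "complex^'m \<Rightarrow> complex^'m \<Rightarrow> complex"
    and \<alpha> \<beta> :: real
    and H\<alpha> H\<beta> :: "(complex^'m \<Rightarrow> complex) set"
    and ip\<alpha> ip\<beta> :: "(complex^'m \<Rightarrow> complex) \<Rightarrow> (complex^'m \<Rightarrow> complex) \<Rightarrow> complex"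
    and T :: "(complex^('m + 'm) \<Rightarrow> complex) set"
    and ipT :: "(complex^('m + 'm) \<Rightarrow> complex) \<Rightarrow> (complex^('m + 'm) \<Rightarrow> complex) \<Rightarrow> complex"
  assumes open_\<Omega>: "open \<Omega>"
    and l_cont: "continuous_on (\<Omega> \<times> \<Omega>) (\<lambda>(z, w). l z w)"
    and \<alpha>: "\<alpha> > 0" and \<beta>: "\<beta> > 0"
    and rk_\<alpha>: "is_rkhs \<Omega> (kpow l \<alpha>) H\<alpha> ip\<alpha>"
    and rk_\<beta>: "is_rkhs \<Omega> (kpow l \<beta>) H\<beta> ip\<beta>"
    and mult_\<alpha>: "\<And>i. bounded_operator fscale H\<alpha> ip\<alpha> (\<lambda>f z. z $ i * f z)"
    and mult_\<beta>: "\<And>i. bounded_operator fscale H\<beta> ip\<beta> (\<lambda>f z. z $ i * f z)"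
    and rk_T: "is_rkhs (sq_dom \<Omega>) (tensor_kernel (kpow l \<alpha>) (kpow l \<beta>)) T ipT"
begin

sublocale T: hilbert_space fscale T ipT
  using rk_T by (rule is_rkhsD)

abbreviation "M \<equiv> tensor_kernel (kpow l \<alpha>) (kpow l \<beta>)"
abbreviation "A0 \<equiv> A0_sub \<Omega> T"
abbreviation "A1 \<equiv> A1_sub \<Omega> T"
abbreviation "S1 \<equiv> S1_space \<Omega> T ipT"
abbreviation "R1 \<equiv> R1_map \<Omega> \<alpha> \<beta>"

text \<open>This is \<open>\<partial>\<close>bar\<open>\<^sub>j log K\<close> at \<open>(z, w)\<close>, with \<open>w\<close> fixed and \<open>z\<close> as the variable in which it is
  differentiated again to form the curvature.\<close>

definition log_conj_deriv :: "'m \<Rightarrow> complex^'m \<Rightarrow> complex^'m \<Rightarrow> complex" where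
  "log_conj_deriv j w z = pderiv_antihol j (l z) w"

definition R1_const :: complex where "R1_const = of_real (1 / sqrt (\<alpha> * \<beta> * (\<alpha> + \<beta>)))"

lemma R1_const_square: "R1_const * R1_const * of_real (\<alpha> * \<beta> * (\<alpha> + \<beta>)) = 1"
proof -
  have "sqrt (\<alpha> * \<beta> * (\<alpha> + \<beta>)) * sqrt (\<alpha> * \<beta> * (\<alpha> + \<beta>)) = \<alpha> * \<beta> * (\<alpha> + \<beta>)"
    using \<alpha> \<beta> by simp
  moreover have "\<alpha> * \<beta> * (\<alpha> + \<beta>) \<noteq> 0" using \<alpha> \<beta> by simp
  ultimately show ?thesis
    unfolding R1_const_def of_real_mult[symmetric] of_real_eq_1_iff by (simp add: field_simps)
qed

lemma R1_const_nonzero: "R1_const \<noteq> 0"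
  using R1_const_square by auto

lemma cnj_c0 [simp]: "cnj R1_const = R1_const"
  by (simp add: R1_const_def)

lemma T_holomorphic: "f \<in> T \<Longrightarrow> holomorphic_sev f (sq_dom \<Omega>)"
  using rk_T by (rule is_rkhsD)

lemma T_outside: "f \<in> T \<Longrightarrow> x \<notin> sq_dom \<Omega> \<Longrightarrow> f x = 0"
  using rk_T by (rule is_rkhsD)

lemma l_isCont_snd:
  assumes "z \<in> \<Omega>" "w \<in> \<Omega>"
  shows "isCont (\<lambda>u. l z u) w"
proof -
  have "continuous_on \<Omega> (\<lambda>u. (\<lambda>(z, w). l z w) (z, u))"
    by (rule continuous_on_compose2[OF l_cont]) (use assms in \<open>auto intro!: continuous_intros\<close>)
  then show ?thesis
    using assms open_\<Omega> by (simp add: continuous_on_eq_continuous_at)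
qed

lemma kpow_diag_continuous: "continuous_on \<Omega> (\<lambda>z. kpow l t z z)"
proof -
  have "continuous_on \<Omega> (\<lambda>z. (\<lambda>(z, w). l z w) (z, z))"
    by (rule continuous_on_compose2[OF l_cont]) (auto intro!: continuous_intros)
  then show ?thesis
    unfolding kpow_def by (auto intro!: continuous_intros)
qed

lemma M_diag_continuous: "continuous_on (sq_dom \<Omega>) (\<lambda>x. M x x)"
proof -
  have "continuous_on (sq_dom \<Omega>) vfst" "continuous_on (sq_dom \<Omega>) vsnd"
    unfolding vfst_def[abs_def] vsnd_def[abs_def] by (intro continuous_intros)+
  then show ?thesis
    unfolding tensor_kernel_def
    by (intro continuous_intros continuous_on_compose2[OF kpow_diag_continuous]) (auto simp: sq_dom_def)
qed

lemma axis_eventually: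
  assumes "z \<in> \<Omega>"
  shows "\<forall>\<^sub>F t in nhds 0. z + axis i t \<in> \<Omega>"
proof -
  have "((\<lambda>t. z + t *s axis i 1) \<longlongrightarrow> z) (at 0)"
    using has_derivative_continuous[OF has_derivative_line[of z "axis i 1" 0]]
    by (simp add: continuous_within)
  then show ?thesis
    using topological_tendstoD[OF _ open_\<Omega> assms] assms
    by (simp add: eventually_nhds_conv_at flip: axis_smult)
qed

text \<open>Hermitian symmetry turns \<open>exp (\<alpha> cnj (l z u))\<close> into a kernel function of \<open>u\<close>, which is holomorphic;
  the logarithm \<open>l\<close> itself need not be Hermitian.\<close>

lemma log_conj_differentiable:
  assumes z: "z \<in> \<Omega>" and w: "w \<in> \<Omega>"
  shows "((\<lambda>t. cnj (l z (w + axis j t))) has_field_derivative cnj (log_conj_deriv j w z)) (at 0)"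
proof -
  have "((\<lambda>t. w + t *s axis j 1) \<longlongrightarrow> w) (at 0)"
    using has_derivative_continuous[OF has_derivative_line[of w "axis j 1" 0]]
    by (simp add: continuous_within)
  then have "((\<lambda>t. l z (w + axis j t)) \<longlongrightarrow> l z w) (at 0)"
    using isCont_tendsto_compose[OF l_isCont_snd[OF z w]] by (simp flip: axis_smult)
  then have cont: "isCont (\<lambda>t. of_real \<alpha> * cnj (l z (w + axis j t))) 0"
    unfolding isCont_def by (auto intro!: tendsto_intros)
  have k: "kernel_at \<Omega> (kpow l \<alpha>) z \<in> H\<alpha>" using rk_\<alpha> z by (rule is_rkhsD)
  have "((\<lambda>t. kernel_at \<Omega> (kpow l \<alpha>) z (w + axis j t)) has_field_derivative
      pderiv_hol j (kernel_at \<Omega> (kpow l \<alpha>) z) w) (at 0)"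
    using holomorphic_sev_pderiv_at[OF is_rkhsD(2)[OF rk_\<alpha> k] w] .
  moreover have "\<forall>\<^sub>F t in nhds 0. kernel_at \<Omega> (kpow l \<alpha>) z (w + axis j t)
      = exp (of_real \<alpha> * cnj (l z (w + axis j t)))"
    using axis_eventually[OF w, of j]
  proof eventually_elim
    case (elim t)
    then show ?case
      using is_rkhs_hermitian[OF rk_\<alpha> z elim] by (simp add: restr_def kpow_def exp_cnj)
  qed
  ultimately have "((\<lambda>t. exp (of_real \<alpha> * cnj (l z (w + axis j t)))) has_field_derivative
      pderiv_hol j (kernel_at \<Omega> (kpow l \<alpha>) z) w) (at 0)"
    by (rule DERIV_eventually_eq)
  from DERIV_continuous_log[OF cont this] obtain E where
    E: "((\<lambda>t. of_real \<alpha> * cnj (l z (w + axis j t))) has_field_derivative E) (at 0)" by blast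
  then have "((\<lambda>t. of_real \<alpha> * cnj (l z (w + axis j t)) / of_real \<alpha>) has_field_derivative E / of_real \<alpha>) (at 0)"
    by (rule DERIV_cdivide)
  then have "((\<lambda>t. cnj (l z (w + axis j t))) has_field_derivative E / of_real \<alpha>) (at 0)"
    using \<alpha> by simp
  moreover from DERIV_imp_deriv[OF this] have "E / of_real \<alpha> = cnj (log_conj_deriv j w z)"
    by (simp add: log_conj_deriv_def pderiv_antihol_def pderiv_hol_def)
  ultimately show ?thesis by simp
qed

text \<open>The exponents enter the logarithmic derivatives of the two kernels only as factors.\<close>

lemma kpow_conj_derivative:
  assumes rk: "is_rkhs \<Omega> (kpow l t) H ip" and z: "z \<in> \<Omega>" and w: "w \<in> \<Omega>"
  shows "((\<lambda>s. kpow l t (w + axis j s) z) has_field_derivative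
    cnj (of_real t * log_conj_deriv j w z * kpow l t z w)) (at 0)"
proof -
  have "((\<lambda>s. exp (of_real t * cnj (l z (w + axis j s)))) has_field_derivative
      exp (of_real t * cnj (l z (w + axis j 0))) * (of_real t * cnj (log_conj_deriv j w z))) (at 0)"
    by (rule DERIV_fun_exp, rule DERIV_cmult, rule log_conj_differentiable[OF z w])
  moreover have "\<forall>\<^sub>F s in nhds 0. exp (of_real t * cnj (l z (w + axis j s))) = kpow l t (w + axis j s) z"
    using axis_eventually[OF w, of j]
  proof eventually_elim
    case (elim s)
    then show ?case
      using is_rkhs_hermitian[OF rk z elim] by (simp add: kpow_def exp_cnj)
  qed
  ultimately have "((\<lambda>s. kpow l t (w + axis j s) z) has_field_derivative
      exp (of_real t * cnj (l z (w + axis j 0))) * (of_real t * cnj (log_conj_deriv j w z))) (at 0)"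
    by (rule DERIV_eventually_eq)
  then show ?thesis by (simp add: kpow_def exp_cnj mult_ac)
qed

text \<open>Up to the factor \<open>\<alpha>\<close> it is the quotient of two elements of \<open>H\<alpha>\<close>: the vector representing a
  derivative at \<open>w\<close>, and the kernel function of \<open>w\<close>.\<close>

lemma log_conj_deriv_holomorphic:
  assumes z: "z \<in> \<Omega>" and w: "w \<in> \<Omega>"
  shows "((\<lambda>t. log_conj_deriv j w (z + axis i t)) has_field_derivative
    pderiv_hol i (log_conj_deriv j w) z) (at 0)"
proof -
  obtain d where d: "d \<in> H\<alpha>"
    "\<And>y. y \<in> \<Omega> \<Longrightarrow> d y = cnj (pderiv_hol j (\<lambda>u. kpow l \<alpha> u y) w)"
    using is_rkhs_pderiv_representer[OF rk_\<alpha> open_\<Omega> w kpow_diag_continuous] by metis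
  have k: "kernel_at \<Omega> (kpow l \<alpha>) w \<in> H\<alpha>" using rk_\<alpha> w by (rule is_rkhsD)
  have dk: "log_conj_deriv j w y = d y / (of_real \<alpha> * kernel_at \<Omega> (kpow l \<alpha>) w y)" if y: "y \<in> \<Omega>" for y
  proof -
    have "d y = of_real \<alpha> * log_conj_deriv j w y * kpow l \<alpha> y w"
      using d(2)[OF y] DERIV_imp_deriv[OF kpow_conj_derivative[OF rk_\<alpha> y w, of j]]
      by (simp add: pderiv_hol_def)
    then show ?thesis using \<alpha> y by (simp add: restr_def kpow_def)
  qed
  have "((\<lambda>t. d (z + axis i t) / (of_real \<alpha> * kernel_at \<Omega> (kpow l \<alpha>) w (z + axis i t)))
      field_differentiable at 0)"
  proof (rule field_differentiable_divide)
    show "(\<lambda>t. d (z + axis i t)) field_differentiable at 0"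
      using holomorphic_sev_pderiv_at[OF is_rkhsD(2)[OF rk_\<alpha> d(1)] z]
      unfolding field_differentiable_def by blast
    show "(\<lambda>t. of_real \<alpha> * kernel_at \<Omega> (kpow l \<alpha>) w (z + axis i t)) field_differentiable at 0"
      using DERIV_cmult[OF holomorphic_sev_pderiv_at[OF is_rkhsD(2)[OF rk_\<alpha> k] z]]
      unfolding field_differentiable_def by blast
    show "of_real \<alpha> * kernel_at \<Omega> (kpow l \<alpha>) w (z + axis i 0) \<noteq> 0"
      using \<alpha> z by (simp add: restr_def kpow_def)
  qed
  then obtain E where "((\<lambda>t. d (z + axis i t) / (of_real \<alpha> * kernel_at \<Omega> (kpow l \<alpha>) w (z + axis i t)))
      has_field_derivative E) (at 0)"
    unfolding field_differentiable_def by blast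
  moreover have "\<forall>\<^sub>F t in nhds 0. d (z + axis i t) / (of_real \<alpha> * kernel_at \<Omega> (kpow l \<alpha>) w (z + axis i t))
      = log_conj_deriv j w (z + axis i t)"
    using axis_eventually[OF z, of i] by eventually_elim (simp add: dk)
  ultimately have E: "((\<lambda>t. log_conj_deriv j w (z + axis i t)) has_field_derivative E) (at 0)"
    by (rule DERIV_eventually_eq)
  then show ?thesis
    using DERIV_imp_deriv[OF E] by (simp add: pderiv_hol_def)
qed

subsection \<open>The map on functions that vanish on the diagonal\<close>

lemma R1_eq:
  assumes "z \<in> \<Omega>"
  shows "R1 f z $ j = R1_const * (of_real \<beta> * pderiv_hol (Inl j) f (diag z) - of_real \<alpha> * pderiv_hol (Inr j) f (diag z))"
  using assms by (simp add: R1_map_def restr_def R1_const_def)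

lemma R1_outside: "z \<notin> \<Omega> \<Longrightarrow> R1 f z = 0"
  by (simp add: R1_map_def restr_def)

lemma R1_add:
  assumes "f \<in> T" "g \<in> T"
  shows "R1 (f + g) = R1 f + R1 g"
proof
  fix z
  show "R1 (f + g) z = (R1 f + R1 g) z"
    using assms by (cases "z \<in> \<Omega>") (simp_all add: vec_eq_iff R1_eq R1_outside
      pderiv_hol_add[OF T_holomorphic T_holomorphic] algebra_simps)
qed

lemma R1_fscale:
  assumes "f \<in> T"
  shows "R1 (fscale c f) = vfscale c (R1 f)"
proof
  fix z
  show "R1 (fscale c f) z = vfscale c (R1 f) z"
    using assms by (cases "z \<in> \<Omega>") (simp_all add: vec_eq_iff R1_eq R1_outside vfscale_def
      pderiv_hol_fscale[OF T_holomorphic] algebra_simps)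
qed

lemma R1_diff: "f \<in> T \<Longrightarrow> g \<in> T \<Longrightarrow> R1 (f - g) = R1 f - R1 g"
  using R1_add[of "f - g" g] by (simp add: algebra_simps)

lemma A0_subset: "A0 \<subseteq> T" and A1_subset: "A1 \<subseteq> A0"
  by (auto simp: A0_sub_def A1_sub_def)

lemma R1_on_A0:
  assumes f: "f \<in> A0" and z: "z \<in> \<Omega>"
  shows "R1 f z $ j = - R1_const * of_real (\<alpha> + \<beta>) * pderiv_hol (Inr j) f (diag z)"
proof -
  have "pderiv_hol (Inl j) f (diag z) = - pderiv_hol (Inr j) f (diag z)"
    by (rule pderiv_hol_vanishing_on_diag[OF T_holomorphic open_\<Omega> z])
      (use f in \<open>auto simp: A0_sub_def\<close>)
  then show ?thesis by (simp add: R1_eq z algebra_simps)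
qed

text \<open>On \<open>\<A>\<^sub>0\<close> the map is a non-zero multiple of the derivatives that define \<open>\<A>\<^sub>1\<close>.\<close>

lemma A1_iff_R1_zero:
  assumes f: "f \<in> A0"
  shows "f \<in> A1 \<longleftrightarrow> R1 f = 0"
proof -
  have nz: "R1_const * of_real (\<alpha> + \<beta>) \<noteq> 0" using R1_const_nonzero \<alpha> \<beta>
    by (simp del: of_real_add)
  have "R1 f = 0 \<longleftrightarrow> (\<forall>z\<in>\<Omega>. \<forall>j. R1 f z $ j = 0)"
    using R1_outside by (auto simp: fun_eq_iff vec_eq_iff)
  also have "\<dots> \<longleftrightarrow> (\<forall>z\<in>\<Omega>. \<forall>j. pderiv_hol (Inr j) f (diag z) = 0)"
    using nz by (simp add: R1_on_A0[OF f])
  finally show ?thesis using f by (auto simp: A0_sub_def A1_sub_def)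
qed

subsection \<open>Representing vectors of the map\<close>

text \<open>The vector that represents \<open>f \<mapsto> \<langle>R1 f w, \<eta>\<rangle>\<close>. It is the combination of conjugate derivatives of
  the two kernels; since these are \<open>\<alpha>\<close> and \<open>\<beta>\<close> times the same logarithmic derivative, the weights \<open>\<beta>\<close>
  and \<open>- \<alpha>\<close> of the map leave the difference of its values at the two components.\<close>

definition R1_representer :: "complex^'m \<Rightarrow> complex^'m \<Rightarrow> complex^('m + 'm) \<Rightarrow> complex" where
  "R1_representer w \<eta> = restr (sq_dom \<Omega>) (\<lambda>y. R1_const * of_real (\<alpha> * \<beta>) *
     (\<Sum>j\<in>UNIV. \<eta> $ j * (log_conj_deriv j w (vfst y) - log_conj_deriv j w (vsnd y))) *
     (kpow l \<alpha> (vfst y) w * kpow l \<beta> (vsnd y) w))"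

lemma M_pderiv:
  assumes w: "w \<in> \<Omega>" and y: "y \<in> sq_dom \<Omega>"
  shows "cnj (pderiv_hol (Inl j) (\<lambda>x. M x y) (diag w)) =
      of_real \<alpha> * log_conj_deriv j w (vfst y) * (kpow l \<alpha> (vfst y) w * kpow l \<beta> (vsnd y) w)"
    and "cnj (pderiv_hol (Inr j) (\<lambda>x. M x y) (diag w)) =
      of_real \<beta> * log_conj_deriv j w (vsnd y) * (kpow l \<alpha> (vfst y) w * kpow l \<beta> (vsnd y) w)"
proof -
  have y1: "vfst y \<in> \<Omega>" and y2: "vsnd y \<in> \<Omega>" using y by (auto simp: sq_dom_def)
  have h: "kpow l \<alpha> w (vfst y) = cnj (kpow l \<alpha> (vfst y) w)" "kpow l \<beta> w (vsnd y) = cnj (kpow l \<beta> (vsnd y) w)"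
    using is_rkhs_hermitian[OF rk_\<alpha> y1 w] is_rkhs_hermitian[OF rk_\<beta> y2 w] by simp_all
  show "cnj (pderiv_hol (Inl j) (\<lambda>x. M x y) (diag w)) =
      of_real \<alpha> * log_conj_deriv j w (vfst y) * (kpow l \<alpha> (vfst y) w * kpow l \<beta> (vsnd y) w)"
    using DERIV_imp_deriv[OF DERIV_cmult_right[OF kpow_conj_derivative[OF rk_\<alpha> y1 w, of j], of "kpow l \<beta> w (vsnd y)"]]
    by (simp add: pderiv_hol_def tensor_kernel_def h mult_ac)
  show "cnj (pderiv_hol (Inr j) (\<lambda>x. M x y) (diag w)) =
      of_real \<beta> * log_conj_deriv j w (vsnd y) * (kpow l \<alpha> (vfst y) w * kpow l \<beta> (vsnd y) w)"
    using DERIV_imp_deriv[OF DERIV_cmult[OF kpow_conj_derivative[OF rk_\<beta> y2 w, of j], of "kpow l \<alpha> w (vfst y)"]]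
    by (simp add: pderiv_hol_def tensor_kernel_def h mult_ac)
qed

lemma R1_representer:
  assumes w: "w \<in> \<Omega>"
  shows "R1_representer w \<eta> \<in> T"
    and "f \<in> T \<Longrightarrow> ipT f (R1_representer w \<eta>) = (\<Sum>j\<in>UNIV. R1 f w $ j * cnj (\<eta> $ j))"
proof -
  have dw: "diag w \<in> sq_dom \<Omega>" using w by simp
  note rep = is_rkhs_pderiv_representer[OF rk_T open_sq_dom[OF open_\<Omega>] dw M_diag_continuous]
  have "\<exists>d. d \<in> T \<and> (\<forall>f\<in>T. ipT f d = pderiv_hol i f (diag w)) \<and>
      (\<forall>y\<in>sq_dom \<Omega>. d y = cnj (pderiv_hol i (\<lambda>z. M z y) (diag w)))" for i
    using rep[of i] by metis
  then obtain d where d: "\<And>i. d i \<in> T" "\<And>i f. f \<in> T \<Longrightarrow> ipT f (d i) = pderiv_hol i f (diag w)"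
    "\<And>i y. y \<in> sq_dom \<Omega> \<Longrightarrow> d i y = cnj (pderiv_hol i (\<lambda>z. M z y) (diag w))"
    by metis
  define v where "v j = fscale (R1_const * \<eta> $ j * of_real \<beta>) (d (Inl j)) - fscale (R1_const * \<eta> $ j * of_real \<alpha>) (d (Inr j))" for j
  have vT: "v j \<in> T" for j by (simp add: v_def d)
  have eq: "R1_representer w \<eta> = (\<Sum>j\<in>UNIV. v j)"
  proof
    fix y
    have app: "(\<Sum>j\<in>UNIV. v j) y = (\<Sum>j\<in>UNIV. v j y)"
      by (induction rule: infinite_finite_induct[where A = UNIV]) auto
    show "R1_representer w \<eta> y = (\<Sum>j\<in>UNIV. v j) y"
    proof (cases "y \<in> sq_dom \<Omega>")
      case True
      then show ?thesis
        unfolding app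
        by (simp add: R1_representer_def restr_def v_def fscale_def d(3) M_pderiv[OF w True]
            sum_distrib_left sum_distrib_right algebra_simps)
    next
      case False
      then have "v j y = 0" for j
        using T_outside[OF vT] by blast
      then show ?thesis unfolding app using False by (simp add: R1_representer_def restr_def)
    qed
  qed
  show "R1_representer w \<eta> \<in> T" unfolding eq by (intro T.V_sum vT)
  show "ipT f (R1_representer w \<eta>) = (\<Sum>j\<in>UNIV. R1 f w $ j * cnj (\<eta> $ j))" if f: "f \<in> T"
    unfolding eq
    by (subst T.ip_sum_right) (auto simp: vT f v_def T.ip_diff_right T.ip_scale_right d R1_eq[OF w]
        intro!: sum.cong simp: algebra_simps)
qed

text \<open>The difference of logarithmic derivatives vanishes on the diagonal, and the map kills \<open>\<A>\<^sub>1\<close>.\<close>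

lemma R1_representer_in_S1:
  assumes w: "w \<in> \<Omega>"
  shows "R1_representer w \<eta> \<in> S1"
proof -
  have "R1_representer w \<eta> \<in> A0"
    using R1_representer(1)[OF w] by (auto simp: A0_sub_def R1_representer_def restr_def)
  moreover have "ipT (R1_representer w \<eta>) g = 0" if g: "g \<in> A1" for g
  proof -
    have gT: "g \<in> T" using g by (simp add: A1_sub_def)
    have "R1 g = 0" using A1_iff_R1_zero g A1_subset by blast
    then have "ipT g (R1_representer w \<eta>) = 0"
      by (simp add: R1_representer(2)[OF w gT])
    then show ?thesis
      using T.ip_cnj[OF gT R1_representer(1)[OF w]] by simp
  qed
  ultimately show ?thesis by (simp add: S1_space_def orth_diff_def)
qed

text \<open>The representing vector contains the factor \<open>log_conj_deriv j w z - log_conj_deriv j w \<zeta>\<close>, which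
  vanishes on the diagonal, so that only this factor has to be differentiated there.\<close>

lemma R1_R1_representer:
  assumes w: "w \<in> \<Omega>"
  shows "R1 (R1_representer w \<eta>) = restr \<Omega> (\<lambda>z. curv_kernel l \<alpha> \<beta> z w *v \<eta>)"
proof -
  have "R1 (R1_representer w \<eta>) z $ i = (curv_kernel l \<alpha> \<beta> z w *v \<eta>) $ i" if z: "z \<in> \<Omega>" for z i
  proof -
    let ?G = "\<lambda>j. log_conj_deriv j w"
    let ?h = "\<lambda>t. \<Sum>j\<in>UNIV. \<eta> $ j * (?G j z - ?G j (z + axis i t))"
    let ?k = "\<lambda>t. kernel_at \<Omega> (kpow l \<beta>) w (z + axis i t)"
    have kH: "kernel_at \<Omega> (kpow l \<beta>) w \<in> H\<beta>" using rk_\<beta> w by (rule is_rkhsD)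
    have h: "(?h has_field_derivative (\<Sum>j\<in>UNIV. \<eta> $ j * (0 - pderiv_hol i (?G j) z))) (at 0)"
      by (intro DERIV_sum DERIV_cmult DERIV_diff DERIV_const log_conj_deriv_holomorphic z w)
    have k: "(?k has_field_derivative pderiv_hol i (kernel_at \<Omega> (kpow l \<beta>) w) z) (at 0)"
      using holomorphic_sev_pderiv_at[OF is_rkhsD(2)[OF rk_\<beta> kH] z] .
    have "((\<lambda>t. R1_const * of_real (\<alpha> * \<beta>) * kpow l \<alpha> z w * (?h t * ?k t)) has_field_derivative
        R1_const * of_real (\<alpha> * \<beta>) * kpow l \<alpha> z w * ((\<Sum>j\<in>UNIV. \<eta> $ j * (0 - pderiv_hol i (?G j) z)) * kpow l \<beta> z w)) (at 0)"
      using DERIV_cmult[OF DERIV_mult[OF h k], of "R1_const * of_real (\<alpha> * \<beta>) * kpow l \<alpha> z w"] z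
      by (simp add: restr_def mult.commute)
    moreover have "\<forall>\<^sub>F t in nhds 0. R1_const * of_real (\<alpha> * \<beta>) * kpow l \<alpha> z w * (?h t * ?k t)
        = R1_representer w \<eta> (diag z + axis (Inr i) t)"
      using axis_eventually[OF z, of i]
      by eventually_elim (use z in \<open>simp add: R1_representer_def restr_def sq_dom_def mult_ac\<close>)
    ultimately have "((\<lambda>t. R1_representer w \<eta> (diag z + axis (Inr i) t)) has_field_derivative
        R1_const * of_real (\<alpha> * \<beta>) * kpow l \<alpha> z w * ((\<Sum>j\<in>UNIV. \<eta> $ j * (0 - pderiv_hol i (?G j) z)) * kpow l \<beta> z w)) (at 0)"
      by (rule DERIV_eventually_eq)
    from DERIV_imp_deriv[OF this]
    have p: "pderiv_hol (Inr i) (R1_representer w \<eta>) (diag z) =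
        - (R1_const * of_real (\<alpha> * \<beta>) * (kpow l \<alpha> z w * kpow l \<beta> z w) * (\<Sum>j\<in>UNIV. \<eta> $ j * pderiv_hol i (?G j) z))"
      by (simp add: pderiv_hol_def sum_negf mult_ac)
    have "R1_representer w \<eta> \<in> A0"
      using R1_representer_in_S1[OF w] by (simp add: S1_space_def orth_diff_def)
    from R1_on_A0[OF this z, of i]
    have "R1 (R1_representer w \<eta>) z $ i = (R1_const * R1_const * of_real (\<alpha> * \<beta> * (\<alpha> + \<beta>))) *
        ((kpow l \<alpha> z w * kpow l \<beta> z w) * (\<Sum>j\<in>UNIV. \<eta> $ j * pderiv_hol i (?G j) z))"
      by (simp add: p mult_ac)
    also have "\<dots> = kpow l (\<alpha> + \<beta>) z w * (\<Sum>j\<in>UNIV. \<eta> $ j * pderiv_hol i (?G j) z)"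
      unfolding R1_const_square by (simp add: kpow_def distrib_right exp_add)
    also have "\<dots> = (curv_kernel l \<alpha> \<beta> z w *v \<eta>) $ i"
      by (simp add: curv_kernel_def matrix_vector_mult_def sum_distrib_left mult_ac
          log_conj_deriv_def[abs_def])
    finally show ?thesis .
  qed
  then show ?thesis
    by (auto simp: fun_eq_iff vec_eq_iff restr_def R1_outside)
qed

lemma R1_eq_0I:
  assumes "\<And>z j. z \<in> \<Omega> \<Longrightarrow> R1 f z $ j = 0"
  shows "R1 f = 0"
proof
  fix z show "R1 f z = 0 z"
    using assms R1_outside by (cases "z \<in> \<Omega>") (simp_all add: vec_eq_iff)
qed

subsection \<open>The orthogonal decomposition\<close>

lemma S1_subset: "S1 \<subseteq> A0" "S1 \<subseteq> T"
  by (auto simp: S1_space_def orth_diff_def A0_sub_def)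

text \<open>Vanishing on the diagonal is orthogonality to kernel functions, so \<open>\<S>\<^sub>1\<close> is an orthogonal
  complement and therefore closed.\<close>

lemma S1_hilbert_space: "hilbert_space fscale S1 ipT"
proof (rule T.orthocomplement_hilbert_space)
  let ?E = "(\<lambda>z. kernel_at (sq_dom \<Omega>) M (diag z)) ` \<Omega> \<union> A1"
  show "?E \<subseteq> T"
    using is_rkhsD(4)[OF rk_T] A0_subset A1_subset by auto
  show "S1 = {f \<in> T. \<forall>g\<in>?E. ipT f g = 0}"
  proof -
    have "ipT f (kernel_at (sq_dom \<Omega>) M (diag z)) = f (diag z)" if "z \<in> \<Omega>" "f \<in> T" for z f
      by (rule is_rkhsD(5)[OF rk_T]) (use that in auto)
    then show ?thesis by (auto simp: S1_space_def orth_diff_def A0_sub_def ball_Un)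
  qed
qed

sublocale S1: hilbert_space fscale S1 ipT
  by (rule S1_hilbert_space)

lemma S1_inter_A1: "f \<in> S1 \<Longrightarrow> f \<in> A1 \<Longrightarrow> f = 0"
  using S1.ip_pos[of f] by (force simp: S1_space_def orth_diff_def)

abbreviation "P \<equiv> orth_proj ipT S1"

lemmas S1_projection = T.orth_proj[OF S1_hilbert_space S1_subset(2)]

lemma A0_diff: "f \<in> A0 \<Longrightarrow> g \<in> A0 \<Longrightarrow> f - g \<in> A0"
  by (auto simp: A0_sub_def)

text \<open>The part of \<open>f \<in> \<A>\<^sub>0\<close> orthogonal to \<open>\<S>\<^sub>1\<close> is orthogonal to the representing vectors of the map,
  so the map kills it.\<close>

lemma P_residual_in_A1:
  assumes f: "f \<in> A0"
  shows "f - P f \<in> A1"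
proof -
  have fT: "f \<in> T" using f A0_subset by blast
  have PA: "P f \<in> A0" using S1_projection(1)[OF fT] S1_subset by blast
  then have PT: "P f \<in> T" using A0_subset by blast
  have "R1 (f - P f) z $ j = 0" if z: "z \<in> \<Omega>" for z j
  proof -
    have rS: "R1_representer z (axis j 1) \<in> S1" by (rule R1_representer_in_S1[OF z])
    have "ipT (f - P f) (R1_representer z (axis j 1)) = 0"
      using S1_projection(2)[OF fT rS] rS S1_subset fT PT by (subst T.ip_diff) auto
    moreover have "ipT (f - P f) (R1_representer z (axis j 1))
        = (\<Sum>k\<in>UNIV. R1 (f - P f) z $ k * cnj (axis j 1 $ k))"
      using fT PT by (intro R1_representer(2) z T.V_diff)
    ultimately show ?thesis
      by (simp add: axis_def if_distrib[of cnj] if_distrib[of "(*) _"] cong: if_cong)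
  qed
  then have "R1 (f - P f) = 0" by (rule R1_eq_0I)
  then show ?thesis using A1_iff_R1_zero[OF A0_diff[OF f PA]] by simp
qed

lemma R1_P:
  assumes f: "f \<in> A0"
  shows "R1 (P f) = R1 f"
proof -
  have fT: "f \<in> T" using f A0_subset by blast
  have "R1 (f - P f) = 0"
    using P_residual_in_A1[OF f] A1_iff_R1_zero A1_subset by blast
  moreover have "R1 (f - P f) = R1 f - R1 (P f)"
    using S1_projection(1)[OF fT] S1_subset(2) by (intro R1_diff fT) auto
  ultimately show ?thesis by simp
qed

lemma P_A1: "f \<in> A1 \<Longrightarrow> P f = 0"
proof (rule S1_projection(4))
  assume f: "f \<in> A1"
  then show fT: "f \<in> T" by (simp add: A1_sub_def)
  fix g assume g: "g \<in> S1"
  then have "ipT g f = 0" using f by (simp add: S1_space_def orth_diff_def)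
  moreover have "g \<in> T" using g S1_subset by blast
  ultimately show "ipT 0 g = ipT f g"
    using T.ip_cnj[of g f] fT by simp
qed simp

lemma P_add:
  assumes "f \<in> T" "g \<in> T"
  shows "P (f + g) = P f + P g"
  by (rule S1_projection(4))
    (use assms S1_projection(1,2) S1_subset(2) in \<open>auto simp: T.ip_add S1.ip_add subset_eq\<close>)

lemma P_fscale:
  assumes "f \<in> T"
  shows "P (fscale c f) = fscale c (P f)"
  by (rule S1_projection(4))
    (use assms S1_projection(1,2) S1_subset(2) in \<open>auto simp: T.ip_scale S1.ip_scale subset_eq\<close>)

subsection \<open>Polynomial multiplication\<close>

abbreviation pmult :: "('m + 'm) cpoly \<Rightarrow> (complex^('m + 'm) \<Rightarrow> complex) \<Rightarrow> complex^('m + 'm) \<Rightarrow> complex" where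
  "pmult p f \<equiv> \<lambda>x. cpoly_eval p x * f x"

text \<open>Multiplication by a coordinate of either component is bounded by the product kernel criterion, and
  the bounded multipliers form an algebra.\<close>

lemma cpoly_multiplier: "bounded_multiplier T ipT (cpoly_eval p)"
proof (rule bounded_multiplier_cpoly_eval)
  fix i :: "'m + 'm"
  show "bounded_multiplier T ipT (\<lambda>x. x $ i)"
  proof (cases i)
    case (Inl j)
    have "bounded_multiplier T ipT (\<lambda>x. vfst x $ j)"
      by (rule product_kernel_multiplier[OF rk_\<alpha> rk_\<beta> rk_T, where p = vfst and q = vsnd])
        (auto simp: sq_dom_def tensor_kernel_def mult_\<alpha>)
    then show ?thesis by (simp add: Inl vfst_def)
  next
    case (Inr j)
    have "bounded_multiplier T ipT (\<lambda>x. vsnd x $ j)"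
      by (rule product_kernel_multiplier[OF rk_\<beta> rk_\<alpha> rk_T, where p = vsnd and q = vfst])
        (auto simp: sq_dom_def tensor_kernel_def mult_\<beta>)
    then show ?thesis by (simp add: Inr vsnd_def)
  qed
qed (rule T.hilbert_space_axioms)

lemma pmult_T: "f \<in> T \<Longrightarrow> pmult p f \<in> T"
  using cpoly_multiplier[of p] unfolding bounded_multiplier_def by blast

lemma pmult_A0: "f \<in> A0 \<Longrightarrow> pmult p f \<in> A0"
  by (simp add: A0_sub_def pmult_T)

lemma pmult_A1: "f \<in> A1 \<Longrightarrow> pmult p f \<in> A1"
  by (simp add: A1_sub_def pmult_T pderiv_hol_cpoly_mult[OF T_holomorphic])

lemma R1_pmult:
  assumes f: "f \<in> A0"
  shows "R1 (pmult p f) = pushforward_action p (R1 f)"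
proof
  fix z
  have fT: "f \<in> T" using f A0_subset by blast
  show "R1 (pmult p f) z = pushforward_action p (R1 f) z"
  proof (cases "z \<in> \<Omega>")
    case True
    moreover from this have "f (diag z) = 0" using f by (simp add: A0_sub_def)
    ultimately show ?thesis
      by (simp add: vec_eq_iff pushforward_action_def R1_eq
          pderiv_hol_cpoly_mult[OF T_holomorphic[OF fT]]) (simp add: algebra_simps)
  qed (simp add: R1_outside pushforward_action_def)
qed

subsection \<open>The Hilbert module structures\<close>

abbreviation act where "act \<equiv> compressed_action ipT S1"

lemma act_eq: "act p f = P (pmult p f)"
  by (simp add: compressed_action_def)

lemma act_S1: "f \<in> S1 \<Longrightarrow> act p f \<in> S1"
  unfolding act_eq using S1_subset by (intro S1_projection(1) pmult_T) auto

lemma S1_hilbert_module: "hilbert_module fscale S1 ipT act"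
proof
  have ST: "f \<in> T" and SA: "f \<in> A0" if "f \<in> S1" for f
    using that S1_subset by auto
  fix p q :: "('m + 'm) cpoly" and f
  show "act 1 f = f" if "f \<in> S1"
    unfolding act_eq using that by (intro S1_projection(4)) (auto simp: cpoly_eval_one ST)
  show "act (p * q) f = act p (act q f)" if f: "f \<in> S1"
  proof -
    \<comment> \<open>Compression is multiplicative because \<open>\<A>\<^sub>1\<close> is invariant.\<close>
    let ?r = "pmult q f - P (pmult q f)"
    have qf: "pmult q f \<in> A0" using SA[OF f] by (rule pmult_A0)
    have Pq: "P (pmult q f) \<in> T" using act_S1[OF f, of q] ST by (simp add: act_eq)
    have r: "pmult p ?r \<in> A1"
      by (intro pmult_A1 P_residual_in_A1 qf)
    have "pmult (p * q) f = pmult p (P (pmult q f)) + pmult p ?r"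
      by (auto simp: fun_eq_iff cpoly_eval_mult algebra_simps)
    then have "P (pmult (p * q) f) = P (pmult p (P (pmult q f))) + P (pmult p ?r)"
      using r A1_subset A0_subset by (simp add: P_add pmult_T Pq subset_eq)
    then show ?thesis using P_A1[OF r] by (simp add: act_eq)
  qed
  show "act (p + q) f = act p f + act q f" if f: "f \<in> S1"
  proof -
    have "pmult (p + q) f = pmult p f + pmult q f"
      by (auto simp: fun_eq_iff cpoly_eval_add algebra_simps)
    then show ?thesis unfolding act_eq using ST[OF f] by (simp add: P_add pmult_T)
  qed
  show "bounded_operator fscale S1 ipT (act p)"
    unfolding bounded_operator_def linear_betw_def
  proof (intro conjI ballI allI)
    show "act p ` S1 \<subseteq> S1" using act_S1 by blast
    show "act p (f + g) = act p f + act p g" if "f \<in> S1" "g \<in> S1" for f g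
    proof -
      have "pmult p (f + g) = pmult p f + pmult p g"
        by (auto simp: fun_eq_iff algebra_simps)
      then show ?thesis unfolding act_eq using that ST by (simp add: P_add pmult_T)
    qed
    show "act p (fscale c f) = fscale c (act p f)" if "f \<in> S1" for c f
    proof -
      have "pmult p (fscale c f) = fscale c (pmult p f)"
        by (auto simp: fun_eq_iff fscale_def)
      then show ?thesis unfolding act_eq using that ST by (simp add: P_fscale pmult_T)
    qed
    obtain C where "\<And>f. f \<in> T \<Longrightarrow> hnorm ipT (pmult p f) \<le> C * hnorm ipT f"
      using cpoly_multiplier[of p] unfolding bounded_multiplier_def by blast
    then have "hnorm ipT (act p f) \<le> C * hnorm ipT f" if "f \<in> S1" for f
      unfolding act_eq using S1_projection(3)[OF pmult_T[OF ST[OF that]]] ST[OF that] order_trans by blast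
    then show "\<exists>C. \<forall>f\<in>S1. hnorm ipT (act p f) \<le> C * hnorm ipT f" by blast
  qed
qed

text \<open>Compression does not change the image under the map, because the map kills the discarded part.\<close>

lemma R1_act: "f \<in> S1 \<Longrightarrow> R1 (act p f) = pushforward_action p (R1 f)"
  unfolding act_eq using S1_subset by (subst R1_P) (auto intro: pmult_A0 R1_pmult)

subsection \<open>The vector valued space\<close>

lemma R1_linear: "linear_betw fscale S1 vfscale UNIV R1"
  using S1_subset by (auto simp: linear_betw_def R1_add R1_fscale subset_eq)

lemma R1_inj: "inj_on R1 S1"
proof (rule inj_onI)
  fix f g assume f: "f \<in> S1" and g: "g \<in> S1" and eq: "R1 f = R1 g"
  have d: "f - g \<in> S1" using f g by simp
  moreover have "R1 (f - g) = 0"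
    using eq f g S1_subset by (simp add: R1_diff subset_eq)
  ultimately have "f - g = 0"
    using S1_inter_A1 A1_iff_R1_zero S1_subset by blast
  then show "f = g" by simp
qed

lemma R1_holomorphic:
  assumes f: "f \<in> T"
  shows "holomorphic_sev (\<lambda>z. R1 f z $ j) \<Omega>"
proof (rule holomorphic_sev_cong[OF _ open_\<Omega> R1_eq])
  have "holomorphic_sev (\<lambda>z. pderiv_hol i f (diag z)) \<Omega>" for i
    by (intro holomorphic_sev_diag holomorphic_sev_pderiv_hol open_sq_dom open_\<Omega> T_holomorphic f)
  then show "holomorphic_sev (\<lambda>z. R1_const * (of_real \<beta> * pderiv_hol (Inl j) f (diag z)
      - of_real \<alpha> * pderiv_hol (Inr j) f (diag z))) \<Omega>"
    by (intro holomorphic_sev_cmult holomorphic_sev_diff)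
qed

text \<open>Carried to the image of the map, the representing vectors become the kernel functions of the
  curvature kernel; in particular a space with this kernel exists.\<close>

lemma R1_image_is_vrkhs:
  "is_vrkhs \<Omega> (curv_kernel l \<alpha> \<beta>) (R1 ` S1) (\<lambda>f g. ipT (inv_into S1 R1 f) (inv_into S1 R1 g))"
  unfolding is_vrkhs_def
proof (intro conjI ballI allI impI)
  show "hilbert_space vfscale (R1 ` S1) (\<lambda>f g. ipT (inv_into S1 R1 f) (inv_into S1 R1 g))"
    by (rule hilbert_space_transport[OF S1_hilbert_space vector_space_vfscale R1_linear R1_inj])
  show "holomorphic_sev (\<lambda>z. f z $ j) \<Omega>" if "f \<in> R1 ` S1" for f j
    using that R1_holomorphic S1_subset by blast
  show "f z = 0" if "f \<in> R1 ` S1" "z \<notin> \<Omega>" for f z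
    using that R1_outside by blast
  fix w \<eta> assume w: "w \<in> \<Omega>"
  note rS = R1_representer_in_S1[OF w, of \<eta>]
  show "restr \<Omega> (\<lambda>z. curv_kernel l \<alpha> \<beta> z w *v \<eta>) \<in> R1 ` S1"
    using rS R1_R1_representer[OF w, of \<eta>] by (metis imageI)
  fix f assume "f \<in> R1 ` S1"
  then obtain g where g: "g \<in> S1" "f = R1 g" by blast
  show "ipT (inv_into S1 R1 f) (inv_into S1 R1 (restr \<Omega> (\<lambda>z. curv_kernel l \<alpha> \<beta> z w *v \<eta>)))
      = (\<Sum>j\<in>UNIV. f w $ j * cnj (\<eta> $ j))"
    unfolding R1_R1_representer[OF w, symmetric] g(2)
    using g(1) rS S1_subset by (simp add: inv_into_f_f[OF R1_inj] R1_representer(2)[OF w] subset_eq)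
qed

text \<open>In any space with the curvature kernel, the kernel functions have the same Gram matrix as the
  representing vectors in \<open>\<S>\<^sub>1\<close>, so the map is unitary onto the whole space. The module structure of the
  target is then inherited from \<open>\<S>\<^sub>1\<close>.\<close>

lemma R1_isomorphism:
  assumes W: "is_vrkhs \<Omega> (curv_kernel l \<alpha> \<beta>) W ipW"
  shows "hilbert_module_isomorphism fscale S1 ipT act vfscale W ipW pushforward_action R1"
proof -
  interpret W: hilbert_space vfscale W ipW
    using W by (simp add: is_vrkhs_def)
  let ?K = "\<lambda>w \<eta>. restr \<Omega> (\<lambda>z. curv_kernel l \<alpha> \<beta> z w *v \<eta>)"
  have KW: "?K w \<eta> \<in> W" and KE: "f \<in> W \<Longrightarrow> ipW f (?K w \<eta>) = (\<Sum>j\<in>UNIV. f w $ j * cnj (\<eta> $ j))"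
    if "w \<in> \<Omega>" for w \<eta> f
    using W that unfolding is_vrkhs_def by auto
  have Wout: "f z = 0" if "f \<in> W" "z \<notin> \<Omega>" for f z
    using W that unfolding is_vrkhs_def by auto
  have ST: "f \<in> T" if "f \<in> S1" for f using that S1_subset by auto
  let ?I = "\<Omega> \<times> (UNIV :: (complex^'m) set)"
  let ?k = "\<lambda>(w, \<eta>). R1_representer w \<eta>" and ?k' = "\<lambda>(w, \<eta>). ?K w \<eta>"
  have coord: "f w = g w" if "\<And>\<eta>. (\<Sum>j\<in>UNIV. f w $ j * cnj (\<eta> $ j)) = (\<Sum>j\<in>UNIV. g w $ j * cnj (\<eta> $ j))"
    for f g :: "complex^'m \<Rightarrow> complex^'m" and w
  proof -
    have "f w $ i = g w $ i" for i
      using that[of "axis i 1"]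
      by (simp add: axis_def if_distrib[of cnj] if_distrib[of "(*) _"] cong: if_cong)
    then show ?thesis by (simp add: vec_eq_iff)
  qed
  have unitary: "linear_betw fscale S1 vfscale W R1" "bij_betw R1 S1 W"
    "\<And>f g. f \<in> S1 \<Longrightarrow> g \<in> S1 \<Longrightarrow> ipW (R1 f) (R1 g) = ipT f g"
  proof -
    have 1: "?k i \<in> S1" if "i \<in> ?I" for i
      using that R1_representer_in_S1 by auto
    have 2: "?k' i \<in> W" if "i \<in> ?I" for i
      using that KW by auto
    have 3: "ipT (?k i) (?k j) = ipW (?k' i) (?k' j)" if "i \<in> ?I" "j \<in> ?I" for i j
      using that by (auto simp: R1_representer KE KW R1_R1_representer)
    have 4: "f = 0" if f: "f \<in> S1" and 0: "\<And>i. i \<in> ?I \<Longrightarrow> ipT f (?k i) = 0" for f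
    proof -
      have "R1 f z = 0" if "z \<in> \<Omega>" for z
        using coord[of "R1 f" z "\<lambda>_. 0"] 0[of "(z, _)"] that
        by (simp add: R1_representer(2)[OF that ST[OF f]])
      then have "R1 f = 0" by (intro R1_eq_0I) simp
      then show ?thesis using f S1_inter_A1 A1_iff_R1_zero S1_subset by blast
    qed
    have 5: "R1 f = g" if f: "f \<in> S1" and g: "g \<in> W"
      and eq: "\<And>i. i \<in> ?I \<Longrightarrow> ipW g (?k' i) = ipT f (?k i)" for f g
    proof
      fix z
      show "R1 f z = g z"
      proof (cases "z \<in> \<Omega>")
        case True
        show ?thesis
          by (rule coord) (use eq[of "(z, _)"] True in \<open>simp add: KE g R1_representer(2)[OF True ST[OF f]]\<close>)
      qed (simp add: R1_outside Wout g)
    qed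
    note u = unitary_of_equal_gram[of fscale S1 ipT vfscale W ipW ?I ?k ?k' R1,
        OF S1_hilbert_space W.hilbert_space_axioms 1 2 3 4 5]
    show "linear_betw fscale S1 vfscale W R1" by (rule u(1))
    show "bij_betw R1 S1 W" by (rule u(2))
    show "ipW (R1 f) (R1 g) = ipT f g" if "f \<in> S1" "g \<in> S1" for f g
      by (rule u(3)) (use that in blast)+
  qed
  interpret S1m: hilbert_module fscale S1 ipT act by (rule S1_hilbert_module)
  have surj: "\<exists>g\<in>S1. f = R1 g" if "f \<in> W" for f
    using unitary(2) that unfolding bij_betw_def by blast
  have norm: "hnorm ipW (R1 f) = hnorm ipT f" if "f \<in> S1" for f
    using that by (simp add: hnorm_def unitary(3))
  have RW: "R1 f \<in> W" if "f \<in> S1" for f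
    using unitary(2) that unfolding bij_betw_def by blast
  have "hilbert_module vfscale W ipW (pushforward_action :: ('m + 'm) cpoly \<Rightarrow> _)"
  proof
    fix p q :: "('m + 'm) cpoly" and f :: "complex^'m \<Rightarrow> complex^'m"
    show "pushforward_action 1 f = f"
      by (auto simp: pushforward_action_def cpoly_eval_one)
    show "pushforward_action (p * q) f = pushforward_action p (pushforward_action q f)"
      by (auto simp: pushforward_action_def cpoly_eval_mult vec_eq_iff)
    show "pushforward_action (p + q) f = pushforward_action p f + pushforward_action q f"
      by (auto simp: pushforward_action_def cpoly_eval_add vec_eq_iff algebra_simps fun_eq_iff)
    obtain C where C: "\<And>f. f \<in> S1 \<Longrightarrow> hnorm ipT (act p f) \<le> C * hnorm ipT f"
      using S1m.act_bounded[of p] unfolding bounded_operator_def by blast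
    show "bounded_operator vfscale W ipW (pushforward_action p)"
      unfolding bounded_operator_def linear_betw_def
    proof (intro conjI ballI allI exI[of _ C])
      show "pushforward_action p ` W \<subseteq> W"
        using surj R1_act[symmetric] RW act_S1 by (metis image_subsetI)
      show "pushforward_action p (f + g) = pushforward_action p f + pushforward_action p g" for f g
        by (auto simp: pushforward_action_def vec_eq_iff algebra_simps fun_eq_iff)
      show "pushforward_action p (vfscale c f) = vfscale c (pushforward_action p f)" for c f
        by (auto simp: pushforward_action_def vfscale_def vec_eq_iff fun_eq_iff)
      fix f assume "f \<in> W"
      then obtain g where g: "g \<in> S1" "f = R1 g" using surj by blast
      then show "hnorm ipW (pushforward_action p f) \<le> C * hnorm ipW f"
        using C[OF g(1)] by (simp add: R1_act[symmetric] norm act_S1)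
    qed
  qed
  then show ?thesis
    unfolding hilbert_module_isomorphism_def
    using S1_hilbert_module unitary R1_act by blast
qed

end

theorem theorem3p5:
  fixes \<Omega> :: "(complex^'m) set"
    and K logK :: "complex^'m \<Rightarrow> complex^'m \<Rightarrow> complex"
    and \<alpha> \<beta> :: real
    and H\<alpha> H\<beta> :: "(complex^'m \<Rightarrow> complex) set"
    and ip\<alpha> ip\<beta> :: "(complex^'m \<Rightarrow> complex) \<Rightarrow> (complex^'m \<Rightarrow> complex) \<Rightarrow> complex"
    and T :: "(complex^('m + 'm) \<Rightarrow> complex) set"
    and ipT :: "(complex^('m + 'm) \<Rightarrow> complex) \<Rightarrow> (complex^('m + 'm) \<Rightarrow> complex) \<Rightarrow> complex"
  assumes domain: "open \<Omega>" "connected \<Omega>" "\<Omega> \<noteq> {}" "bounded \<Omega>"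
    and K_sesqui: "sesqui_analytic K \<Omega>"
    and log_cont: "continuous_on (\<Omega> \<times> \<Omega>) (\<lambda>(z, w). logK z w)"
    and log_branch: "\<And>z w. z \<in> \<Omega> \<Longrightarrow> w \<in> \<Omega> \<Longrightarrow> exp (logK z w) = K z w"
    and exponents: "\<alpha> > 0" "\<beta> > 0"
    and nonneg: "nonneg_definite \<Omega> (kpow logK \<alpha>)" "nonneg_definite \<Omega> (kpow logK \<beta>)"
    and rkhs_\<alpha>: "is_rkhs \<Omega> (kpow logK \<alpha>) H\<alpha> ip\<alpha>"
    and rkhs_\<beta>: "is_rkhs \<Omega> (kpow logK \<beta>) H\<beta> ip\<beta>"
    and mult_\<alpha>: "\<And>i. bounded_operator fscale H\<alpha> ip\<alpha> (\<lambda>f z. z $ i * f z)"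
    and mult_\<beta>: "\<And>i. bounded_operator fscale H\<beta> ip\<beta> (\<lambda>f z. z $ i * f z)"
    and tensor: "is_rkhs (sq_dom \<Omega>) (tensor_kernel (kpow logK \<alpha>) (kpow logK \<beta>)) T ipT"
  shows "(\<exists>W ipW. is_vrkhs \<Omega> (curv_kernel logK \<alpha> \<beta>) W ipW) \<and>
    (\<forall>W ipW. is_vrkhs \<Omega> (curv_kernel logK \<alpha> \<beta>) W ipW \<longrightarrow>
      hilbert_module_isomorphism
        fscale (S1_space \<Omega> T ipT) ipT (compressed_action ipT (S1_space \<Omega> T ipT))
        vfscale W ipW pushforward_action
        (R1_map \<Omega> \<alpha> \<beta>))"
proof -
  interpret kernel_power_pair \<Omega> logK \<alpha> \<beta> H\<alpha> H\<beta> ip\<alpha> ip\<beta> T ipT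
    by unfold_locales (fact domain(1) log_cont exponents rkhs_\<alpha> rkhs_\<beta> mult_\<alpha> mult_\<beta> tensor)+
  show ?thesis
    using R1_image_is_vrkhs R1_isomorphism by blast
qed

end
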